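(* Let $s\in(0,1)$ and let $d,h>0$. Let $u:\mathbb{R}\to\mathbb{R}$ be an $s$-minimal graph in $(-d,d)$, with $u\in C(-\infty,-d)\cap C^{1,\frac{1+s}{2}}(-d-h,-d)$. Assume that $$u(x)=-u(-x)\quad\text{for all }x\in(d,+\infty)$$ and that $$u(x)\le 0\quad\text{for all }x\in(d,+\infty).$$ Then $$u(x)=-u(-x)\quad\text{for all }x\in(-\infty,+\infty),$$ $$u(x)\ge 0\quad\text{for all }x\in(-\infty,0],$$ and $$u(x)\le 0\quad\text{for all }x\in[0,+\infty).$$
   Context: Fix $s\in(0,1)$. For measurable sets $A,B\subseteq\mathbb{R}^2$ let $$\mathcal{L}_s(A,B):=\iint_{A\times B}\frac{dX\,dY}{|X-Y|^{2+s}},$$ and for measurable $E,\Omega\subseteq\mathbb{R}^2$, with $E^c:=\mathbb{R}^2\setminus E$ and $\Omega^c:=\mathbb{R}^2\setminus\Omega$, let $$\mathrm{Per}_s(E,\Omega):=\mathcal{L}_s(E\cap\Omega,E^c\cap\Omega)+\mathcal{L}_s(E\cap\Omega,E^c\cap\Omega^c)+\mathcal{L}_s(E\cap\Omega^c,E^c\cap\Omega).$$ For a measurable function $w:\mathbb{R}\to\mathbb{R}$ let $E_w:=\{(x,y)\in\mathbb{R}^2 : y<w(x)\}$. Given $a<b$ and $u_0\in C(\mathbb{R})$, a function $u\in L^\infty_{\rm loc}(\mathbb{R})$ is an $s$-minimal graph in $(a,b)$ (with external datum $u_0$) if: - $u(x)=u_0(x)$ for every $x\in\mathbb{R}\setminus(a,b)$;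 - for every $L>\|u\|_{L^\infty((a,b))}$ and every measurable function $v:\mathbb{R}\to\mathbb{R}$ such that $|v(x)|\le L$ for all $x\in(a,b)$ and $v=u_0$ in $\mathbb{R}\setminus(a,b)$, one has $\mathrm{Per}_s(E_u,\Omega_L)\le\mathrm{Per}_s(E_v,\Omega_L)$, where $\Omega_L:=(a,b)\times(-L,L)$. "$u$ is an $s$-minimal graph in $(-d,d)$" means that this holds with $(a,b)=(-d,d)$ for some external datum $u_0\in C(\mathbb{R})$. It is known that an $s$-minimal graph is continuous in $(a,b)$ (after modification on a null set); pointwise statements on $u$ in $(a,b)$ refer to this continuous representative. *)

theory Defs
  imports "HOL-Analysis.Analysis" "HOL-Probability.Essential_Supremum"
begin

text \<open>
  The kernel takes the value \<open>0\<close> on the diagonal \<open>X = Y\<close> (division by zero). The diagonal is a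
  null set, so this does not affect the integral. The norm on \<open>real \<times> real\<close> is Euclidean.
\<close>
definition interaction ::
  "real \<Rightarrow> (real \<times> real) set \<Rightarrow> (real \<times> real) set \<Rightarrow> ennreal" where
  "interaction s A B =
     (\<integral>\<^sup>+ Z \<in> A \<times> B. ennreal (1 / norm (fst Z - snd Z) powr (2 + s)) \<partial>(lebesgue \<Otimes>\<^sub>M lebesgue))"

definition Per :: "real \<Rightarrow> (real \<times> real) set \<Rightarrow> (real \<times> real) set \<Rightarrow> ennreal" where
  "Per s E \<Omega> =
     interaction s (E \<inter> \<Omega>) (- E \<inter> \<Omega>)
   + interaction s (E \<inter> \<Omega>) (- E \<inter> - \<Omega>)
   + interaction s (E \<inter> - \<Omega>) (- E \<inter> \<Omega>)"

definition subgraph :: "(real \<Rightarrow> real) \<Rightarrow> (real \<times> real) set" where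
  "subgraph w = {(x, y). y < w x}"

definition Linf_norm_on :: "real set \<Rightarrow> (real \<Rightarrow> real) \<Rightarrow> ereal" where
  "Linf_norm_on S u = esssup (lebesgue_on S) (\<lambda>x. ereal \<bar>u x\<bar>)"

definition Linf_loc :: "(real \<Rightarrow> real) \<Rightarrow> bool" where
  "Linf_loc u \<longleftrightarrow>
     u \<in> borel_measurable lebesgue \<and> (\<forall>K. compact K \<longrightarrow> Linf_norm_on K u < \<infinity>)"

definition s_minimal_graph_datum ::
  "real \<Rightarrow> real \<Rightarrow> real \<Rightarrow> (real \<Rightarrow> real) \<Rightarrow> (real \<Rightarrow> real) \<Rightarrow> bool" where
  "s_minimal_graph_datum s a b u0 u \<longleftrightarrow>
     Linf_loc u \<and>
     (\<forall>x. x \<notin> {a<..<b} \<longrightarrow> u x = u0 x) \<and>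
     (\<forall>L v. Linf_norm_on {a<..<b} u < ereal L \<longrightarrow>
        v \<in> borel_measurable lebesgue \<longrightarrow>
        (\<forall>x\<in>{a<..<b}. \<bar>v x\<bar> \<le> L) \<longrightarrow>
        (\<forall>x. x \<notin> {a<..<b} \<longrightarrow> v x = u0 x) \<longrightarrow>
        Per s (subgraph u) ({a<..<b} \<times> {-L<..<L}) \<le> Per s (subgraph v) ({a<..<b} \<times> {-L<..<L}))"

definition s_minimal_graph :: "real \<Rightarrow> real \<Rightarrow> real \<Rightarrow> (real \<Rightarrow> real) \<Rightarrow> bool" where
  "s_minimal_graph s a b u \<longleftrightarrow>
     (\<exists>u0. continuous_on UNIV u0 \<and> s_minimal_graph_datum s a b u0 u)"

text \<open>
  An s-minimal graph is determined inside \<open>(a,b)\<close> only up to a null set, and it has a representative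
  that is continuous in \<open>(a,b)\<close>. The next predicate says that \<open>w\<close> is this representative of \<open>u\<close>.
  Outside \<open>(a,b)\<close> the function is not modified. Nothing is required of the one-sided limits of \<open>w\<close>
  at \<open>a\<close> and \<open>b\<close> from inside the interval: an s-minimal graph may jump there.
\<close>
definition continuous_representative ::
  "real \<Rightarrow> real \<Rightarrow> (real \<Rightarrow> real) \<Rightarrow> (real \<Rightarrow> real) \<Rightarrow> bool" where
  "continuous_representative a b u w \<longleftrightarrow>
     continuous_on {a<..<b} w \<and>
     (AE x in lebesgue. x \<in> {a<..<b} \<longrightarrow> w x = u x) \<and>
     (\<forall>x. x \<notin> {a<..<b} \<longrightarrow> w x = u x)"

text \<open>
  The space \<open>C\<^bsup>1,\<alpha>\<^esup>(S)\<close> for an open set \<open>S\<close>, in the sense of a finite Hoelder norm on \<open>S\<close>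
  (one constant for all of \<open>S\<close>, not only on compact subsets).
\<close>
definition C1_holder_on :: "real \<Rightarrow> real set \<Rightarrow> (real \<Rightarrow> real) \<Rightarrow> bool" where
  "C1_holder_on \<alpha> S u \<longleftrightarrow>
     (\<exists>u'. (\<forall>x\<in>S. (u has_real_derivative u' x) (at x)) \<and>
           bounded (u ` S) \<and> bounded (u' ` S) \<and>
           (\<exists>C. \<forall>x\<in>S. \<forall>y\<in>S. \<bar>u' x - u' y\<bar> \<le> C * \<bar>x - y\<bar> powr \<alpha>))"

end

theory Submission
  imports Defs "HOL-Real_Asymp.Real_Asymp"
begin

text \<open>
  The theorem rests on two facts about the minimization problem: the minimizer with a given exterior
  datum is unique almost everywhere, and two transformations do not increase the
  perimeter: the odd reflection, which takes \<open>w\<close> to \<open>\<lambda>x. - w (- x)\<close>, and polarization.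

  Odd symmetry. The odd reflection of a graph amounts to the central reflection of its subgraph
  followed by passing to the complement, up to a null set. Both preserve the perimeter in a window that
  is symmetric about the origin. Since the exterior datum is odd, the odd reflection of a minimizer is
  again a minimizer with the same datum, and uniqueness shows that it is the same function.

  Sign. Polarization replaces \<open>w\<close> on the left half-line by the larger, and on the right half-line by the
  smaller, of \<open>w x\<close> and \<open>w (- x)\<close>. It does not increase the perimeter, because the kernel is larger
  for two points on the same side of the axis than for one of them and the mirror image of the other
  (\<open>Per_polarize_le\<close>). The datum is nonpositive on the right and odd, so polarization does not alter it.
  By uniqueness a minimizer is equal to its polarization, that is \<open>w x \<le> w (- x)\<close> for \<open>x > 0\<close>, and
  with odd symmetry this says \<open>w x \<le> 0\<close>. All these identities hold almost everywhere, and everywhere by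
  continuity.

  Uniqueness (\<open>minimizer_unique\<close>). The perimeter is submodular,
  \<open>Per (E \<inter> F) + Per (E \<union> F) \<le> Per E + Per F\<close>, and the defect contains the interaction between
  \<open>F - E\<close> and \<open>E - F\<close>. Apply this to the subgraph \<open>F\<close> of one minimizer \<open>g\<close> and the subgraph \<open>E\<close> of another
  one \<open>f\<close>, translated upwards by \<open>t > 0\<close>. The intersection and the union are admissible competitors, so that
  the defect vanishes and one of the two differences is a null set. It is not \<open>E - F\<close>, because off the
  interval the translated graph is strictly higher. Hence \<open>g \<le> f + t\<close> almost everywhere, and \<open>t\<close> is
  arbitrary. Since perimeters are subtracted here, they have to be finite, and this follows from
  the finite fractional perimeter of rectangles (\<open>kernel_measure_box_Compl_finite\<close>).
\<close>

section \<open>The perimeter as the measure of a set of pairs\<close>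

definition kernel :: "real \<Rightarrow> (real \<times> real) \<times> (real \<times> real) \<Rightarrow> ennreal" where
  "kernel s Z = ennreal (1 / norm (fst Z - snd Z) powr (2 + s))"

definition kernel_measure :: "real \<Rightarrow> ((real \<times> real) \<times> (real \<times> real)) measure" where
  "kernel_measure s = density lborel (kernel s)"

text \<open>
  The pairs that contribute to the perimeter of \<open>E\<close> in \<open>\<Omega>\<close>: the three interactions in \<^const>\<open>Per\<close> are
  taken over disjoint products whose union is this set. Inequalities between perimeters thereby
  become inclusions between sets of pairs.
\<close>
definition cut :: "'a set \<Rightarrow> 'a set \<Rightarrow> ('a \<times> 'a) set" where
  "cut E \<Omega> = {(X, Y). X \<in> E \<and> Y \<notin> E \<and> (X \<in> \<Omega> \<or> Y \<in> \<Omega>)}"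

lemma borel_measurable_kernel [measurable]: "kernel s \<in> borel_measurable borel"
proof -
  have [measurable]: "(\<lambda>Z :: (real \<times> real) \<times> (real \<times> real). norm (fst Z - snd Z)) \<in> borel_measurable borel"
    by (intro borel_measurable_continuous_onI continuous_intros)
  show ?thesis
    unfolding kernel_def by measurable
qed

lemma sets_kernel_measure [simp, measurable_cong]: "sets (kernel_measure s) = sets borel"
  by (simp add: kernel_measure_def)

lemma emeasure_kernel_measure:
  "S \<in> sets borel \<Longrightarrow> emeasure (kernel_measure s) S = (\<integral>\<^sup>+Z. kernel s Z * indicator S Z \<partial>lborel)"
  unfolding kernel_measure_def by (intro emeasure_density) auto

lemma borel_Times [measurable]:
  fixes A :: "'a::second_countable_topology set" and B :: "'b::second_countable_topology set"
  assumes "A \<in> sets borel" "B \<in> sets borel"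
  shows "A \<times> B \<in> sets borel"
  using assms by (simp flip: borel_prod)

lemma cut_eq:
  "cut E \<Omega> = (E \<times> - E) \<inter> (\<Omega> \<times> UNIV \<union> UNIV \<times> \<Omega>)"
  unfolding cut_def by auto

lemma borel_cut [measurable]:
  fixes E :: "'a::second_countable_topology set"
  assumes "E \<in> sets borel" "\<Omega> \<in> sets borel"
  shows "cut E \<Omega> \<in> sets borel"
  unfolding cut_eq using assms by (intro sets.Int sets.Un borel_Times) auto

lemma sigma_finite_lebesgue: "sigma_finite_measure (lebesgue :: 'a::euclidean_space measure)"
proof -
  from lborel.sigma_finite_countable obtain F :: "'a set set" where
    "countable F" "F \<subseteq> sets lborel" "\<Union>F = space lborel" "\<forall>a\<in>F. emeasure lborel a \<noteq> \<infinity>"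
    by blast
  then show ?thesis
    by (intro sigma_finite_measure.intro exI[of _ F])
       (auto simp: subset_eq intro!: exI)
qed

text \<open>
  The product of two completed measures is in general neither the product of the uncompleted ones
  nor its completion, but for a Borel integrand Tonelli reduces the question to each factor, and there
  completion does not change integrals.
\<close>
lemma nn_integral_lebesgue_prod:
  fixes f :: "'a::euclidean_space \<times> 'b::euclidean_space \<Rightarrow> ennreal"
  assumes [measurable]: "f \<in> borel_measurable borel"
  shows "(\<integral>\<^sup>+Z. f Z \<partial>(lebesgue \<Otimes>\<^sub>M lebesgue)) = (\<integral>\<^sup>+Z. f Z \<partial>lborel)"
proof -
  have m: "f \<in> borel_measurable (lborel \<Otimes>\<^sub>M lborel)"
    by (simp add: lborel_prod)
  have id: "(\<lambda>x. x) \<in> lebesgue \<Otimes>\<^sub>M lebesgue \<rightarrow>\<^sub>M (lborel :: 'a measure) \<Otimes>\<^sub>M (lborel :: 'b measure)"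
    by (rule measurable_pair)
       (auto intro!: measurable_compose[OF measurable_fst] measurable_compose[OF measurable_snd]
             measurable_completion simp: comp_def)
  have m': "f \<in> borel_measurable (lebesgue \<Otimes>\<^sub>M lebesgue)"
    using measurable_compose[OF id m] by simp
  have "(\<integral>\<^sup>+Z. f Z \<partial>(lebesgue \<Otimes>\<^sub>M lebesgue)) = (\<integral>\<^sup>+x. \<integral>\<^sup>+y. f (x, y) \<partial>lebesgue \<partial>lebesgue)"
    by (rule sigma_finite_measure.nn_integral_fst[OF sigma_finite_lebesgue m', symmetric])
  also have "\<dots> = (\<integral>\<^sup>+x. \<integral>\<^sup>+y. f (x, y) \<partial>lborel \<partial>lborel)"
    by (simp add: nn_integral_completion)
  also have "\<dots> = (\<integral>\<^sup>+Z. f Z \<partial>lborel)"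
    using lborel.nn_integral_fst[OF m] by (simp add: lborel_prod)
  finally show ?thesis .
qed

lemma interaction_eq:
  assumes [measurable]: "A \<in> sets borel" "B \<in> sets borel"
  shows "interaction s A B = emeasure (kernel_measure s) (A \<times> B)"
  unfolding interaction_def kernel_def[symmetric]
  by (subst nn_integral_lebesgue_prod) (simp_all add: emeasure_kernel_measure)

lemma Per_eq_cut:
  assumes [measurable]: "E \<in> sets borel" "\<Omega> \<in> sets borel"
  shows "Per s E \<Omega> = emeasure (kernel_measure s) (cut E \<Omega>)"
proof -
  let ?A = "(E \<inter> \<Omega>) \<times> (- E \<inter> \<Omega>)" and ?B = "(E \<inter> \<Omega>) \<times> (- E \<inter> - \<Omega>)"
    and ?C = "(E \<inter> - \<Omega>) \<times> (- E \<inter> \<Omega>)"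
  have "Per s E \<Omega> = emeasure (kernel_measure s) ?A + emeasure (kernel_measure s) ?B
      + emeasure (kernel_measure s) ?C"
    unfolding Per_def by (simp add: interaction_eq)
  also have "\<dots> = emeasure (kernel_measure s) (?A \<union> ?B) + emeasure (kernel_measure s) ?C"
    by (subst plus_emeasure) auto
  also have "\<dots> = emeasure (kernel_measure s) (?A \<union> ?B \<union> ?C)"
    by (subst plus_emeasure) auto
  also have "?A \<union> ?B \<union> ?C = cut E \<Omega>"
    by (auto simp: cut_def)
  finally show ?thesis .
qed

lemma AE_lebesgue_fst:
  fixes P :: "'a::euclidean_space \<Rightarrow> bool"
  assumes "AE x in lebesgue. P x"
  shows "AE X in (lebesgue :: ('a \<times> 'b::euclidean_space) measure). P (fst X)"
proof -
  from assms have "AE x in lborel. P x" by (simp add: AE_completion_iff)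
  then obtain N where N: "{x. \<not> P x} \<subseteq> N" "N \<in> null_sets lborel"
    by (elim AE_E3) auto
  have "N \<times> (UNIV :: 'b set) \<in> null_sets (lborel \<Otimes>\<^sub>M lborel)"
    by (intro lborel.times_in_null_sets1 N) auto
  then have "AE X in (lborel :: ('a \<times> 'b) measure). X \<notin> N \<times> UNIV"
    by (simp add: lborel_prod AE_not_in)
  then have "AE X in (lborel :: ('a \<times> 'b) measure). P (fst X)"
    by eventually_elim (use N in auto)
  then show ?thesis by (rule AE_completion)
qed

lemma AE_lebesgue_pair:
  fixes P :: "'a::euclidean_space \<Rightarrow> bool"
  assumes "AE X in lebesgue. P X"
  shows "AE Z in (lebesgue \<Otimes>\<^sub>M lebesgue). P (fst Z) \<and> P (snd Z)"
proof -
  from assms obtain N where N: "{x. \<not> P x} \<subseteq> N" "N \<in> null_sets lebesgue"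
    by (elim AE_E3) auto
  interpret leb: sigma_finite_measure "lebesgue :: 'a measure" by (rule sigma_finite_lebesgue)
  have "AE Z in (lebesgue \<Otimes>\<^sub>M lebesgue). Z \<notin> N \<times> (UNIV :: 'a set)"
    by (intro AE_not_in leb.times_in_null_sets1 N) auto
  moreover have "AE Z in (lebesgue \<Otimes>\<^sub>M lebesgue). Z \<notin> (UNIV :: 'a set) \<times> N"
    by (intro AE_not_in leb.times_in_null_sets2 N) auto
  ultimately show ?thesis
    by eventually_elim (use N in auto)
qed

text \<open>
  This allows the minimal graph, which is only Lebesgue measurable, to be exchanged for its
  continuous representative, which is Borel.
\<close>
lemma Per_cong_AE:
  assumes "AE X in lebesgue. X \<in> E \<longleftrightarrow> X \<in> F"
  shows "Per s E \<Omega> = Per s F \<Omega>"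
proof -
  note AE = AE_lebesgue_pair[OF assms]
  have "interaction s (E \<inter> V) (- E \<inter> W) = interaction s (F \<inter> V) (- F \<inter> W)" for V W
    unfolding interaction_def
    by (rule nn_integral_cong_AE, use AE in eventually_elim) (auto split: split_indicator)
  then show ?thesis by (simp add: Per_def)
qed

section \<open>Isometries and the exchange of the two points\<close>

lemma distr_map_prod_lborel:
  fixes S :: "'a::euclidean_space \<Rightarrow> 'a" and T :: "'b::euclidean_space \<Rightarrow> 'b"
  assumes [measurable]: "S \<in> borel_measurable borel" "T \<in> borel_measurable borel"
    and S: "distr lborel borel S = lborel" and T: "distr lborel borel T = lborel"
  shows "distr lborel borel (map_prod S T) = lborel"
proof -
  have "lborel \<Otimes>\<^sub>M lborel = distr lborel borel S \<Otimes>\<^sub>M distr lborel borel T"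
    by (simp add: S T)
  also have "\<dots> = distr (lborel \<Otimes>\<^sub>M lborel) (borel \<Otimes>\<^sub>M borel) (\<lambda>(x, y). (S x, T y))"
    by (rule pair_measure_distr) (auto simp: T lborel.sigma_finite_measure_axioms)
  also have "(\<lambda>(x, y). (S x, T y)) = map_prod S T" by auto
  finally show ?thesis by (simp add: lborel_prod borel_prod)
qed

lemma borel_measurable_map_prod [measurable]:
  fixes S :: "'a::euclidean_space \<Rightarrow> 'a" and T :: "'b::euclidean_space \<Rightarrow> 'b"
  assumes [measurable]: "S \<in> borel_measurable borel" "T \<in> borel_measurable borel"
  shows "map_prod S T \<in> borel_measurable borel"
  unfolding map_prod_def case_prod_beta borel_prod[symmetric] by measurable

lemma nn_integral_lborel_invariant:
  fixes T :: "'a::euclidean_space \<Rightarrow> 'a"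
  assumes [measurable]: "T \<in> borel_measurable borel" "f \<in> borel_measurable borel"
    and "distr lborel borel T = lborel"
  shows "(\<integral>\<^sup>+x. f (T x) \<partial>lborel) = (\<integral>\<^sup>+x. f x \<partial>lborel)"
proof -
  have "(\<integral>\<^sup>+x. f x \<partial>lborel) = (\<integral>\<^sup>+x. f x \<partial>distr lborel borel T)"
    by (simp add: assms)
  then show ?thesis by (simp add: nn_integral_distr)
qed

lemma kernel_measure_invariant:
  assumes [measurable]: "T \<in> borel_measurable borel" "S \<in> sets borel"
    and T: "distr lborel borel T = lborel" and iso: "\<And>X Y. norm (T X - T Y) = norm (X - Y)"
  shows "emeasure (kernel_measure s) (map_prod T T -` S) = emeasure (kernel_measure s) S"
proof -
  have [measurable]: "map_prod T T -` S \<in> sets borel"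
    using measurable_sets[OF borel_measurable_map_prod[OF assms(1,1)] assms(2)] by simp
  have "emeasure (kernel_measure s) (map_prod T T -` S)
      = (\<integral>\<^sup>+Z. kernel s (map_prod T T Z) * indicator S (map_prod T T Z) \<partial>lborel)"
    by (subst emeasure_kernel_measure)
       (auto intro!: nn_integral_cong simp: kernel_def iso split: split_indicator)
  also have "\<dots> = emeasure (kernel_measure s) S"
    by (subst nn_integral_lborel_invariant[OF _ _ distr_map_prod_lborel[OF _ _ T T],
          where f = "\<lambda>Z. kernel s Z * indicator S Z"])
       (auto simp: emeasure_kernel_measure)
  finally show ?thesis .
qed

lemma borel_measurable_swap [measurable]:
  "prod.swap \<in> borel_measurable (borel :: ('a::second_countable_topology \<times> 'a) measure)"
  unfolding prod.swap_def borel_prod[symmetric] by measurable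

lemma lborel_distr_swap: "distr lborel borel prod.swap = (lborel :: ('a::euclidean_space \<times> 'a) measure)"
proof -
  have "distr lborel borel prod.swap = distr lborel lborel (prod.swap :: 'a \<times> 'a \<Rightarrow> _)"
    by (rule distr_cong) auto
  also have "\<dots> = lborel"
    using lborel_pair.distr_pair_swap[where 'a = 'a and 'b = 'a]
    by (simp add: lborel_prod prod.swap_def[abs_def] case_prod_beta')
  finally show ?thesis .
qed

lemma kernel_measure_swap:
  assumes [measurable]: "S \<in> sets borel"
  shows "emeasure (kernel_measure s) (prod.swap -` S) = emeasure (kernel_measure s) S"
proof -
  note sw = lborel_distr_swap[where 'a = "real \<times> real"]
  have [measurable]: "prod.swap -` S \<in> sets borel"
    using measurable_sets[of prod.swap borel borel S] by simp
  have "emeasure (kernel_measure s) (prod.swap -` S)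
      = (\<integral>\<^sup>+Z. kernel s (prod.swap Z) * indicator S (prod.swap Z) \<partial>lborel)"
    by (subst emeasure_kernel_measure)
       (auto intro!: nn_integral_cong simp: kernel_def norm_minus_commute split: split_indicator)
  also have "\<dots> = emeasure (kernel_measure s) S"
    by (subst nn_integral_lborel_invariant[OF _ _ sw, where f = "\<lambda>Z. kernel s Z * indicator S Z"])
       (auto simp: emeasure_kernel_measure)
  finally show ?thesis .
qed

section \<open>The fractional perimeter of a rectangle is finite\<close>

text \<open>
  The integrand is a multiple of the Cauchy density with centre \<open>c\<close> and scale \<open>r\<close>, so that an
  antiderivative is elementary.
\<close>
lemma nn_integral_cauchy_density:
  assumes r: "0 < (r::real)"
  shows "(\<integral>\<^sup>+y. ennreal (1 / (r\<^sup>2 + (c - y)\<^sup>2)) \<partial>lborel) \<le> ennreal (pi / r)"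
proof -
  define f where "f y = 1 / (r\<^sup>2 + (c - y)\<^sup>2)" for y
  have [measurable]: "f \<in> borel_measurable borel"
    unfolding f_def by measurable
  have right: "(\<integral>\<^sup>+y. ennreal (f y) * indicator {c..} y \<partial>lborel) = ennreal (pi / 2 / r - arctan ((c - c) / r) / r)"
  proof (rule nn_integral_FTC_atLeast[where F = "\<lambda>y. arctan ((y - c) / r) / r"])
    fix y
    have f_eq: "1 / (1 + ((y - c) / r)\<^sup>2) * (1 / r) / r = f y"
    proof -
      have "r\<^sup>2 * (1 + ((y - c) / r)\<^sup>2) = r\<^sup>2 + (c - y)\<^sup>2"
        using r by (simp add: field_simps power2_eq_square)
      then show ?thesis
        unfolding f_def by (simp add: power2_eq_square mult_ac)
    qed
    have "((\<lambda>y. (y - c) / r) has_real_derivative 1 / r) (at y)"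
      using r by (auto intro!: derivative_eq_intros)
    from DERIV_cdivide[OF DERIV_chain2[OF DERIV_arctan this], of r]
    show "((\<lambda>y. arctan ((y - c) / r) / r) has_real_derivative f y) (at y)"
      by (simp only: inverse_eq_divide f_eq)
    show "0 \<le> f y" by (simp add: f_def)
  next
    have "filterlim (\<lambda>y. (y - c) / r) at_top at_top"
      using r by real_asymp
    from filterlim_compose[OF tendsto_arctan_at_top this]
    have "((\<lambda>y. arctan ((y - c) / r)) \<longlongrightarrow> pi / 2) at_top" .
    from tendsto_divide[OF this tendsto_const[of r]] r
    show "((\<lambda>y. arctan ((y - c) / r) / r) \<longlongrightarrow> pi / 2 / r) at_top" by simp
  qed simp
  have left: "(\<integral>\<^sup>+y. ennreal (f y) * indicator {..c} y \<partial>lborel) = (\<integral>\<^sup>+y. ennreal (f y) * indicator {c..} y \<partial>lborel)"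
    by (subst nn_integral_real_affine[where c = "-1" and t = "2 * c"])
       (auto intro!: nn_integral_cong simp: f_def power2_commute split: split_indicator)
  have "(\<integral>\<^sup>+y. ennreal (f y) \<partial>lborel)
      \<le> (\<integral>\<^sup>+y. ennreal (f y) * indicator {..c} y + ennreal (f y) * indicator {c..} y \<partial>lborel)"
    by (intro nn_integral_mono) (auto split: split_indicator)
  also have "\<dots> = (\<integral>\<^sup>+y. ennreal (f y) * indicator {..c} y \<partial>lborel) + (\<integral>\<^sup>+y. ennreal (f y) * indicator {c..} y \<partial>lborel)"
    by (intro nn_integral_add) auto
  also have "\<dots> = ennreal (pi / r)"
    using r by (simp add: left right flip: ennreal_plus)
  finally show ?thesis by (simp add: f_def)
qed

text \<open>
  Of the exponent \<open>2 + s\<close>, the part \<open>s\<close> is spent on the horizontal distance alone. What remains can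
  be integrated in the vertical variable in closed form and still has the right homogeneity.
\<close>
lemma kernel_le_cauchy:
  assumes "0 < s" "x1 < y1"
  shows "kernel s ((x1, x2), (y1, y2))
    \<le> ennreal ((y1 - x1) powr (- s)) * ennreal (1 / ((y1 - x1)\<^sup>2 + (x2 - y2)\<^sup>2))"
proof -
  define N where "N = norm ((x1, x2) - (y1, y2))"
  have N2: "N\<^sup>2 = (y1 - x1)\<^sup>2 + (x2 - y2)\<^sup>2"
    by (simp add: N_def norm_prod_def power2_commute)
  have N: "y1 - x1 \<le> N"
    using norm_fst_le[of "x1 - y1" "x2 - y2"] assms by (simp add: N_def)
  then have "0 < N" using assms by simp
  have "1 / N powr (2 + s) = N powr (- s) * (1 / N\<^sup>2)"
    using \<open>0 < N\<close> by (simp add: powr_add powr_minus field_simps)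
  also have "\<dots> \<le> (y1 - x1) powr (- s) * (1 / N\<^sup>2)"
    using assms N by (intro mult_right_mono powr_mono2') auto
  finally have "1 / N powr (2 + s) \<le> (y1 - x1) powr (- s) * (1 / ((y1 - x1)\<^sup>2 + (x2 - y2)\<^sup>2))"
    by (simp only: N2)
  moreover have "kernel s ((x1, x2), (y1, y2)) = ennreal (1 / N powr (2 + s))"
    by (simp add: kernel_def N_def)
  ultimately show ?thesis
    by (simp add: ennreal_leI flip: ennreal_mult)
qed

text \<open>
  By homogeneity a point at distance \<open>\<delta>\<close> from a half-plane interacts with it with strength
  proportional to \<open>\<delta> powr (- s)\<close>.
\<close>
lemma nn_integral_kernel_half_plane:
  assumes s: "0 < s" and "x1 < b"
  shows "(\<integral>\<^sup>+Y. kernel s ((x1, x2), Y) * indicator {Y. b \<le> fst Y} Y \<partial>lborel) \<le> ennreal (pi / s * (b - x1) powr (- s))"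
proof -
  have cl: "{Y :: real \<times> real. b \<le> fst Y} \<in> sets borel"
    by (intro borel_closed closed_Collect_le continuous_intros)
  have "(\<lambda>Y. kernel s ((x1, x2), Y)) \<in> borel_measurable borel"
    by (rule measurable_compose[OF _ borel_measurable_kernel])
       (intro borel_measurable_continuous_onI continuous_intros)
  with cl have m: "(\<lambda>Y. kernel s ((x1, x2), Y) * indicator {Y. b \<le> fst Y} Y) \<in> borel_measurable (lborel \<Otimes>\<^sub>M lborel)"
    unfolding lborel_prod by measurable
  have "(\<integral>\<^sup>+Y. kernel s ((x1, x2), Y) * indicator {Y. b \<le> fst Y} Y \<partial>lborel)
      = (\<integral>\<^sup>+y1. \<integral>\<^sup>+y2. kernel s ((x1, x2), (y1, y2)) * indicator {Y. b \<le> fst Y} (y1, y2) \<partial>lborel \<partial>lborel)"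
    using lborel.nn_integral_fst[OF m] by (simp add: lborel_prod)
  also have "\<dots> \<le> (\<integral>\<^sup>+y1. ennreal (pi * (y1 - x1) powr (- 1 - s)) * indicator {b..} y1 \<partial>lborel)"
  proof (intro nn_integral_mono)
    fix y1 :: real
    show "(\<integral>\<^sup>+y2. kernel s ((x1, x2), (y1, y2)) * indicator {Y. b \<le> fst Y} (y1, y2) \<partial>lborel)
        \<le> ennreal (pi * (y1 - x1) powr (- 1 - s)) * indicator {b..} y1"
    proof (cases "b \<le> y1")
      case True
      then have r: "0 < y1 - x1" using \<open>x1 < b\<close> by simp
      have "(\<integral>\<^sup>+y2. kernel s ((x1, x2), (y1, y2)) * indicator {Y. b \<le> fst Y} (y1, y2) \<partial>lborel)
          \<le> (\<integral>\<^sup>+y2. ennreal ((y1 - x1) powr (- s)) * ennreal (1 / ((y1 - x1)\<^sup>2 + (x2 - y2)\<^sup>2)) \<partial>lborel)"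
        using True r s by (intro nn_integral_mono) (auto intro!: kernel_le_cauchy)
      also have "\<dots> = ennreal ((y1 - x1) powr (- s)) * (\<integral>\<^sup>+y2. ennreal (1 / ((y1 - x1)\<^sup>2 + (x2 - y2)\<^sup>2)) \<partial>lborel)"
        by (intro nn_integral_cmult) measurable
      also have "\<dots> \<le> ennreal ((y1 - x1) powr (- s)) * ennreal (pi / (y1 - x1))"
        by (intro mult_left_mono nn_integral_cauchy_density r) auto
      also have "\<dots> = ennreal (pi * (y1 - x1) powr (- 1 - s))"
        using r by (simp add: powr_diff powr_minus field_simps flip: ennreal_mult)
      finally show ?thesis using True by simp
    qed simp
  qed
  also have "\<dots> = ennreal (0 - (- (pi / s * (b - x1) powr (- s))))"
  proof (rule nn_integral_FTC_atLeast[where F = "\<lambda>y. - (pi / s * (y - x1) powr (- s))"])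
    fix y assume "b \<le> y"
    then have "0 < y - x1" using \<open>x1 < b\<close> by simp
    then show "((\<lambda>y. - (pi / s * (y - x1) powr (- s))) has_real_derivative pi * (y - x1) powr (- 1 - s)) (at y)"
      using s by (auto intro!: derivative_eq_intros simp: powr_diff powr_minus field_simps)
  next
    show "((\<lambda>y. - (pi / s * (y - x1) powr (- s))) \<longlongrightarrow> 0) at_top"
      using s by real_asymp
  qed auto
  finally show ?thesis by simp
qed

text \<open>
  The power \<open>\<delta> powr (- s)\<close> of the distance to the edge is integrable because \<open>s < 1\<close>. It is infinite
  in the limit at the edge itself, but the edge is a null set.
\<close>
lemma kernel_measure_box_half_plane_finite:
  assumes s: "0 < s" "s < 1" and "a \<le> b"
  shows "emeasure (kernel_measure s) (({a..b} \<times> {c..e}) \<times> {Y. b \<le> fst Y}) < \<infinity>"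
proof -
  let ?R = "{a..b} \<times> {c..e}" and ?H = "{Y :: real \<times> real. b \<le> fst Y}"
  have cl: "?H \<in> sets borel" "?R \<in> sets borel"
    by (intro borel_closed closed_Collect_le continuous_intros closed_Times closed_atLeastAtMost)+
  have m: "(\<lambda>Z. kernel s Z * indicator (?R \<times> ?H) Z) \<in> borel_measurable (lborel \<Otimes>\<^sub>M lborel)"
    using cl unfolding lborel_prod by measurable
  let ?g = "\<lambda>X. ennreal (pi / s * (b - fst X) powr (- s)) * indicator ?R X"
  have mg: "?g \<in> borel_measurable (lborel \<Otimes>\<^sub>M lborel)"
    by measurable
  have "emeasure (kernel_measure s) (?R \<times> ?H) = (\<integral>\<^sup>+X. \<integral>\<^sup>+Y. kernel s (X, Y) * indicator (?R \<times> ?H) (X, Y) \<partial>lborel \<partial>lborel)"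
    using lborel.nn_integral_fst[OF m] cl by (simp add: lborel_prod emeasure_kernel_measure)
  also have "\<dots> \<le> (\<integral>\<^sup>+X. ?g X \<partial>lborel)"
  proof (rule nn_integral_mono_AE)
    have "AE x in lebesgue. x \<noteq> b"
      by (intro AE_completion AE_lborel_singleton)
    from AE_lebesgue_fst[OF this] have "AE X in (lborel :: (real \<times> real) measure). fst X \<noteq> b"
      by (simp add: AE_completion_iff)
    then show "AE X in lborel. (\<integral>\<^sup>+Y. kernel s (X, Y) * indicator (?R \<times> ?H) (X, Y) \<partial>lborel) \<le> ?g X"
    proof eventually_elim
      case (elim X)
      show ?case
      proof (cases "X \<in> ?R")
        case True
        then have "fst X < b" using elim by auto
        from nn_integral_kernel_half_plane[OF s(1) this, of "snd X"] True
        show ?thesis by (simp add: indicator_times mem_Times_iff)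
      next
        case False
        then have "indicator (?R \<times> ?H) (X, Y) = (0 :: ennreal)" for Y
          by auto
        then show ?thesis by simp
      qed
    qed
  qed
  also have "\<dots> = (\<integral>\<^sup>+x. \<integral>\<^sup>+y. ?g (x, y) \<partial>lborel \<partial>lborel)"
    using lborel.nn_integral_fst[OF mg] by (simp only: lborel_prod)
  also have "\<dots> = (\<integral>\<^sup>+x. (ennreal (pi / s * (b - x) powr (- s)) * indicator {a..b} x) * emeasure lborel {c..e} \<partial>lborel)"
    by (intro nn_integral_cong)
       (simp add: indicator_times nn_integral_cmult_indicator mult.assoc[symmetric])
  also have "\<dots> = (\<integral>\<^sup>+x. ennreal (pi / s * (b - x) powr (- s)) * indicator {a..b} x \<partial>lborel) * emeasure lborel {c..e}"
    by (intro nn_integral_multc) measurable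
  also have "(\<integral>\<^sup>+x. ennreal (pi / s * (b - x) powr (- s)) * indicator {a..b} x \<partial>lborel)
      = (\<integral>\<^sup>+x. ennreal (indicator {0..b - a} x * (pi / s * x powr (- s))) \<partial>lborel)"
    by (subst nn_integral_real_affine[where c = "-1" and t = b])
       (auto intro!: nn_integral_cong split: split_indicator)
  also have "\<dots> = ennreal (pi / s * ((b - a) powr (- s + 1) / (- s + 1)))"
    using s \<open>a \<le> b\<close>
    by (intro nn_integral_has_integral_lebesgue has_integral_mult_right has_integral_powr_from_0) auto
  finally show ?thesis
    by (rule le_less_trans) (simp add: ennreal_mult_less_top emeasure_lborel_Icc_eq)
qed

lemma borel_half_planes [measurable]:
  "{Y :: real \<times> real. t \<le> fst Y} \<in> sets borel" "{Y :: real \<times> real. fst Y \<le> t} \<in> sets borel"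
  "{Y :: real \<times> real. t \<le> snd Y} \<in> sets borel" "{Y :: real \<times> real. snd Y \<le> t} \<in> sets borel"
  by (intro borel_closed closed_Collect_le continuous_intros)+

text \<open>
  The complement of a rectangle is the union of four half-planes, and isometries carry each of them
  to the position treated above.
\<close>
lemma kernel_measure_box_Compl_finite:
  assumes s: "0 < s" "s < 1" and "a \<le> b" "c \<le> e"
  shows "emeasure (kernel_measure s) (({a..b} \<times> {c..e}) \<times> - ({a<..<b} \<times> {c<..<e})) < \<infinity>"
proof -
  let ?\<mu> = "emeasure (kernel_measure s)" and ?R = "{a..b} \<times> {c..e}"
  have neg: "distr lborel borel uminus = (lborel :: (real \<times> real) measure)"
    using lborel_affine[of "-1" "0 :: real \<times> real"] by (simp add: density_1)
  note swap = lborel_distr_swap[where 'a = real]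
  have right: "?\<mu> (({a..b} \<times> {c..e}) \<times> {Y. b \<le> fst Y}) < \<infinity>" if "a \<le> b" for a b c e
    using kernel_measure_box_half_plane_finite[OF s that] .
  have left: "?\<mu> (({a..b} \<times> {c..e}) \<times> {Y. fst Y \<le> a}) < \<infinity>" if "a \<le> b" for a b c e
  proof -
    have eq: "({a..b} \<times> {c..e}) \<times> {Y. fst Y \<le> a}
        = map_prod uminus uminus -` (({- b..- a} \<times> {- e..- c}) \<times> {Y. - a \<le> fst Y})"
      by auto
    have inv: "?\<mu> (map_prod uminus uminus -` (({- b..- a} \<times> {- e..- c}) \<times> {Y. - a \<le> fst Y})) = ?\<mu> (({- b..- a} \<times> {- e..- c}) \<times> {Y. - a \<le> fst Y})"
      by (rule kernel_measure_invariant[OF _ _ neg])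
         (simp_all add: norm_minus_commute borel_half_planes borel_closed closed_Times)
    show ?thesis
      unfolding eq inv using right[of "- b" "- a"] that by simp
  qed
  have iso: "norm (prod.swap X - prod.swap Y) = norm (X - Y)" for X Y :: "real \<times> real"
    by (simp add: norm_prod_def add.commute)
  have top: "?\<mu> (?R \<times> {Y. e \<le> snd Y}) < \<infinity>"
  proof -
    have eq: "?R \<times> {Y. e \<le> snd Y} = map_prod prod.swap prod.swap -` (({c..e} \<times> {a..b}) \<times> {Y. e \<le> fst Y})"
      by auto
    have inv: "?\<mu> (map_prod prod.swap prod.swap -` (({c..e} \<times> {a..b}) \<times> {Y. e \<le> fst Y})) = ?\<mu> (({c..e} \<times> {a..b}) \<times> {Y. e \<le> fst Y})"
      by (rule kernel_measure_invariant[OF _ _ swap])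
         (simp_all add: iso borel_half_planes borel_closed closed_Times)
    show ?thesis
      unfolding eq inv using right[OF \<open>c \<le> e\<close>] by simp
  qed
  have bottom: "?\<mu> (?R \<times> {Y. snd Y \<le> c}) < \<infinity>"
  proof -
    have eq: "?R \<times> {Y. snd Y \<le> c} = map_prod prod.swap prod.swap -` (({c..e} \<times> {a..b}) \<times> {Y. fst Y \<le> c})"
      by auto
    have inv: "?\<mu> (map_prod prod.swap prod.swap -` (({c..e} \<times> {a..b}) \<times> {Y. fst Y \<le> c})) = ?\<mu> (({c..e} \<times> {a..b}) \<times> {Y. fst Y \<le> c})"
      by (rule kernel_measure_invariant[OF _ _ swap])
         (simp_all add: iso borel_half_planes borel_closed closed_Times)
    show ?thesis
      unfolding eq inv using left[OF \<open>c \<le> e\<close>] by simp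
  qed
  have [measurable]: "?R \<in> sets borel"
    by (intro borel_closed closed_Times closed_atLeastAtMost)
  have "?R \<times> - ({a<..<b} \<times> {c<..<e}) \<subseteq> (?R \<times> {Y. fst Y \<le> a} \<union> ?R \<times> {Y. b \<le> fst Y})
      \<union> (?R \<times> {Y. snd Y \<le> c} \<union> ?R \<times> {Y. e \<le> snd Y})"
    by auto
  then have "?\<mu> (?R \<times> - ({a<..<b} \<times> {c<..<e})) \<le> ?\<mu> ((?R \<times> {Y. fst Y \<le> a} \<union> ?R \<times> {Y. b \<le> fst Y})
      \<union> (?R \<times> {Y. snd Y \<le> c} \<union> ?R \<times> {Y. e \<le> snd Y}))"
    by (intro emeasure_mono) auto
  also have "\<dots> \<le> (?\<mu> (?R \<times> {Y. fst Y \<le> a}) + ?\<mu> (?R \<times> {Y. b \<le> fst Y}))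
      + (?\<mu> (?R \<times> {Y. snd Y \<le> c}) + ?\<mu> (?R \<times> {Y. e \<le> snd Y}))"
    by (intro order.trans[OF emeasure_subadditive] add_mono) auto
  also have "\<dots> < \<infinity>"
    using left[OF \<open>a \<le> b\<close>] right[OF \<open>a \<le> b\<close>] top bottom by simp
  finally show ?thesis .
qed

section \<open>Uniqueness of minimizers by sliding\<close>

text \<open>
  Both sides count pairs. A pair in both \<open>cut (E \<inter> F)\<close> and \<open>cut (E \<union> F)\<close> lies in both cuts on the
  right, and a pair in one of them lies in at least one cut on the right. A pair that leads from
  \<open>F - E\<close> to \<open>E - F\<close> is in \<open>cut F\<close> only, and neither the intersection nor the union counts it; this is
  the third term, which measures how far the inequality is from an equality.
\<close>
lemma cut_submodular:
  assumes [measurable]: "E \<in> sets borel" "F \<in> sets borel" "\<Omega> \<in> sets borel"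
    and sub: "F - E \<subseteq> \<Omega>"
  shows "emeasure (kernel_measure s) (cut (E \<inter> F) \<Omega>) + emeasure (kernel_measure s) (cut (E \<union> F) \<Omega>)
      + emeasure (kernel_measure s) ((F - E) \<times> (E - F))
    \<le> emeasure (kernel_measure s) (cut E \<Omega>) + emeasure (kernel_measure s) (cut F \<Omega>)"
proof -
  let ?\<mu> = "emeasure (kernel_measure s)"
  let ?A = "cut (E \<inter> F) \<Omega>" and ?B = "cut (E \<union> F) \<Omega>" and ?D = "(F - E) \<times> (E - F)"
  have "?\<mu> ?A + ?\<mu> ?B + ?\<mu> ?D = ?\<mu> (?A \<union> ?B) + ?\<mu> (?A \<inter> ?B) + ?\<mu> ?D"
    by (subst emeasure_Un_Int) auto
  also have "\<dots> = ?\<mu> (?A \<union> ?B \<union> ?D) + ?\<mu> (?A \<inter> ?B)"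
  proof -
    have "(?A \<union> ?B) \<inter> ?D = {}"
      by (auto simp: cut_def)
    then have "?\<mu> (?A \<union> ?B \<union> ?D) = ?\<mu> (?A \<union> ?B) + ?\<mu> ?D"
      by (intro plus_emeasure[symmetric]) auto
    then show ?thesis by (simp add: ac_simps)
  qed
  also have "\<dots> \<le> ?\<mu> (cut E \<Omega> \<union> cut F \<Omega>) + ?\<mu> (cut E \<Omega> \<inter> cut F \<Omega>)"
  proof (intro add_mono emeasure_mono)
    show "?A \<union> ?B \<union> ?D \<subseteq> cut E \<Omega> \<union> cut F \<Omega>" "?A \<inter> ?B \<subseteq> cut E \<Omega> \<inter> cut F \<Omega>"
      using sub by (auto simp: cut_def)
  qed auto
  also have "\<dots> = ?\<mu> (cut E \<Omega>) + ?\<mu> (cut F \<Omega>)"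
    by (subst emeasure_Un_Int) auto
  finally show ?thesis .
qed

text \<open>
  The kernel is positive off the diagonal, and disjoint sets have no diagonal pairs.
\<close>
lemma null_if_kernel_measure_Times_eq_0:
  assumes [measurable]: "A \<in> sets borel" "B \<in> sets borel"
    and "A \<inter> B = {}" and 0: "emeasure (kernel_measure s) (A \<times> B) = 0"
  shows "emeasure lborel A = 0 \<or> emeasure lborel B = 0"
proof -
  have "AE Z in lborel. kernel s Z * indicator (A \<times> B) Z = 0"
    using 0 by (simp add: emeasure_kernel_measure nn_integral_0_iff_AE)
  then have "AE Z in lborel. Z \<notin> A \<times> B"
    by eventually_elim
       (use \<open>A \<inter> B = {}\<close> in \<open>auto simp: kernel_def indicator_def split: if_splits\<close>)
  then have "emeasure lborel (A \<times> B) = 0"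
    by (subst (asm) AE_iff_measurable[where N = "A \<times> B"]) auto
  then show ?thesis
    using lborel.emeasure_pair_measure_Times[of A lborel B] by (simp add: lborel_prod)
qed

text \<open>
  If passing to \<open>E \<inter> F\<close> and \<open>E \<union> F\<close> lowers neither perimeter, submodularity leaves no room for the
  interaction between \<open>F - E\<close> and \<open>E - F\<close>.
\<close>
lemma minimizers_nested:
  assumes [measurable]: "E \<in> sets borel" "F \<in> sets borel" "\<Omega> \<in> sets borel"
    and sub: "F - E \<subseteq> \<Omega>"
    and E: "Per s E \<Omega> \<le> Per s (E \<union> F) \<Omega>" "Per s E \<Omega> < \<infinity>"
    and F: "Per s F \<Omega> \<le> Per s (E \<inter> F) \<Omega>" "Per s F \<Omega> < \<infinity>"
  shows "emeasure lborel (F - E) = 0 \<or> emeasure lborel (E - F) = 0"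
proof (rule null_if_kernel_measure_Times_eq_0)
  have "Per s E \<Omega> + Per s F \<Omega> + emeasure (kernel_measure s) ((F - E) \<times> (E - F))
      \<le> Per s (E \<inter> F) \<Omega> + Per s (E \<union> F) \<Omega> + emeasure (kernel_measure s) ((F - E) \<times> (E - F))"
    using add_mono[OF E(1) F(1)] by (intro add_right_mono) (simp add: add.commute)
  also have "\<dots> \<le> Per s E \<Omega> + Per s F \<Omega>"
    using cut_submodular[OF assms(1-4), of s] by (simp add: Per_eq_cut)
  finally have "Per s E \<Omega> + Per s F \<Omega> + emeasure (kernel_measure s) ((F - E) \<times> (E - F))
      \<le> Per s E \<Omega> + Per s F \<Omega> + 0" by simp
  then show "emeasure (kernel_measure s) ((F - E) \<times> (E - F)) = 0"
    using E(2) F(2) by (subst (asm) ennreal_add_left_cancel_le) auto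
qed auto

lemma Per_mono_window:
  assumes [measurable]: "E \<in> sets borel" "\<Omega> \<in> sets borel" "\<Omega>' \<in> sets borel" and "\<Omega> \<subseteq> \<Omega>'"
  shows "Per s E \<Omega> \<le> Per s E \<Omega>'"
proof -
  have "cut E \<Omega> \<subseteq> cut E \<Omega>'"
    using assms(4) by (auto simp: cut_def)
  then show ?thesis
    by (simp add: Per_eq_cut emeasure_mono)
qed

text \<open>
  The additional contribution of a larger window comes from pairs with both points off the smaller
  one, and there the two sets coincide. It is the same finite number on both sides and cancels.
\<close>
lemma Per_le_in_subwindow:
  assumes [measurable]: "E \<in> sets borel" "F \<in> sets borel" "\<Omega> \<in> sets borel" "\<Omega>' \<in> sets borel"
    and sub: "\<Omega> \<subseteq> \<Omega>'" and off: "E - \<Omega> = F - \<Omega>"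
    and le: "Per s E \<Omega>' \<le> Per s F \<Omega>'" and fin: "Per s E \<Omega>' < \<infinity>"
  shows "Per s E \<Omega> \<le> Per s F \<Omega>"
proof -
  let ?\<mu> = "emeasure (kernel_measure s)" and ?R = "cut E \<Omega>' - cut E \<Omega>"
  have R: "cut F \<Omega>' - cut F \<Omega> = ?R"
    using off by (auto simp: cut_def)
  have split: "Per s G \<Omega>' = ?\<mu> (cut G \<Omega>' - cut G \<Omega>) + Per s G \<Omega>" if [measurable]: "G \<in> sets borel" for G
  proof -
    have "?\<mu> (cut G \<Omega>' - cut G \<Omega>) + ?\<mu> (cut G \<Omega>) = ?\<mu> ((cut G \<Omega>' - cut G \<Omega>) \<union> cut G \<Omega>)"
      by (intro plus_emeasure) auto
    moreover have "(cut G \<Omega>' - cut G \<Omega>) \<union> cut G \<Omega> = cut G \<Omega>'"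
      using sub by (auto simp: cut_def)
    ultimately show ?thesis
      by (simp add: Per_eq_cut)
  qed
  have "?\<mu> ?R + Per s E \<Omega> \<le> ?\<mu> ?R + Per s F \<Omega>"
    using le by (simp add: split R)
  moreover have "?\<mu> ?R \<noteq> top"
    using fin by (auto simp: split)
  ultimately show ?thesis
    by (simp add: ennreal_add_left_cancel_le)
qed

lemma Per_invariant:
  assumes [measurable]: "E \<in> sets borel" "\<Omega> \<in> sets borel" and T [measurable]: "T \<in> borel_measurable borel"
    and "distr lborel borel T = lborel" "\<And>X Y. norm (T X - T Y) = norm (X - Y)"
  shows "Per s (T -` E) (T -` \<Omega>) = Per s E \<Omega>"
proof -
  have [measurable]: "T -` A \<in> sets borel" if "A \<in> sets borel" for A
    using measurable_sets[OF T that] by simp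
  have "cut (T -` E) (T -` \<Omega>) = map_prod T T -` cut E \<Omega>"
    by (auto simp: cut_def)
  then show ?thesis
    by (simp add: Per_eq_cut kernel_measure_invariant assms)
qed

lemma Per_Compl:
  assumes [measurable]: "E \<in> sets borel" "\<Omega> \<in> sets borel"
  shows "Per s (- E) \<Omega> = Per s E \<Omega>"
proof -
  have "cut (- E) \<Omega> = prod.swap -` cut E \<Omega>"
    by (auto simp: cut_def)
  then show ?thesis
    by (simp add: Per_eq_cut kernel_measure_swap)
qed

lemma borel_subgraph [measurable]:
  assumes [measurable]: "f \<in> borel_measurable borel"
  shows "subgraph f \<in> sets borel"
proof -
  have "subgraph f = {Z \<in> space (borel \<Otimes>\<^sub>M borel). snd Z < f (fst Z)}"
    by (auto simp: subgraph_def borel_prod)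
  also have "\<dots> \<in> sets (borel \<Otimes>\<^sub>M borel)"
    by measurable
  finally show ?thesis by (simp only: borel_prod)
qed

lemma subgraph_min: "subgraph f \<inter> subgraph g = subgraph (\<lambda>x. min (f x) (g x))"
  by (auto simp: subgraph_def)

lemma emeasure_subgraph_Diff:
  assumes [measurable]: "f \<in> borel_measurable borel" "g \<in> borel_measurable borel"
  shows "emeasure lborel (subgraph g - subgraph f) = (\<integral>\<^sup>+x. ennreal (g x - f x) \<partial>lborel)"
proof -
  have vimage: "Pair x -` (subgraph g - subgraph f) = {f x..<g x}" for x
    by (auto simp: subgraph_def)
  have "emeasure lborel (subgraph g - subgraph f) = (\<integral>\<^sup>+x. emeasure lborel (Pair x -` (subgraph g - subgraph f)) \<partial>lborel)"
    unfolding lborel_prod[symmetric] by (rule lborel.emeasure_pair_measure_alt) (simp only: lborel_prod sets_lborel, measurable)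
  also have "(\<integral>\<^sup>+x. emeasure lborel (Pair x -` (subgraph g - subgraph f)) \<partial>lborel) = (\<integral>\<^sup>+x. ennreal (g x - f x) \<partial>lborel)"
  proof (intro nn_integral_cong)
    fix x show "emeasure lborel (Pair x -` (subgraph g - subgraph f)) = ennreal (g x - f x)"
      unfolding vimage by (cases "f x \<le> g x") (auto simp: ennreal_neg)
  qed
  finally show ?thesis .
qed

lemma emeasure_subgraph_Diff_eq_0_iff:
  assumes [measurable]: "f \<in> borel_measurable borel" "g \<in> borel_measurable borel"
  shows "emeasure lborel (subgraph g - subgraph f) = 0 \<longleftrightarrow> (AE x in lborel. g x \<le> f x)"
  by (subst emeasure_subgraph_Diff)
     (simp_all add: nn_integral_0_iff_AE ennreal_eq_0_iff)

text \<open>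
  Minimality of a Borel function with its own values off \<open>(a,b)\<close> as datum, tested with Borel
  competitors only. The bound \<open>M\<close> replaces the essential supremum, and it holds at every point of the
  interval, so that the height of a competitor can be compared with that of the window.
\<close>
definition minimizer :: "real \<Rightarrow> real \<Rightarrow> real \<Rightarrow> real \<Rightarrow> (real \<Rightarrow> real) \<Rightarrow> bool" where
  "minimizer s a b M f \<longleftrightarrow>
     f \<in> borel_measurable borel \<and> (\<forall>x\<in>{a<..<b}. \<bar>f x\<bar> \<le> M) \<and>
     (\<forall>L>M. \<forall>v. v \<in> borel_measurable borel \<longrightarrow> (\<forall>x\<in>{a<..<b}. \<bar>v x\<bar> \<le> L) \<longrightarrow>
        (\<forall>x. x \<notin> {a<..<b} \<longrightarrow> v x = f x) \<longrightarrow>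
        Per s (subgraph f) ({a<..<b} \<times> {-L<..<L}) \<le> Per s (subgraph v) ({a<..<b} \<times> {-L<..<L}))"

lemma minimizerD:
  assumes "minimizer s a b M f" "M < L" "v \<in> borel_measurable borel"
    "\<And>x. x \<in> {a<..<b} \<Longrightarrow> \<bar>v x\<bar> \<le> L" "\<And>x. x \<notin> {a<..<b} \<Longrightarrow> v x = f x"
  shows "Per s (subgraph f) ({a<..<b} \<times> {-L<..<L}) \<le> Per s (subgraph v) ({a<..<b} \<times> {-L<..<L})"
  using assms unfolding minimizer_def by blast

lemma minimizer_borel: "minimizer s a b M f \<Longrightarrow> f \<in> borel_measurable borel"
  and minimizer_bound: "minimizer s a b M f \<Longrightarrow> x \<in> {a<..<b} \<Longrightarrow> \<bar>f x\<bar> \<le> M"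
  unfolding minimizer_def by blast+

text \<open>
  The competitor that vanishes in \<open>(a,b)\<close> has finite perimeter: of the two points of each pair in its
  cut, one is in a rectangle, either the lower or the upper half of the window, and the other one
  outside that rectangle.
\<close>
lemma minimizer_Per_finite:
  assumes "0 < s" "s < 1" "a < b" "minimizer s a b M f" "M < L"
  shows "Per s (subgraph f) ({a<..<b} \<times> {-L<..<L}) < \<infinity>"
proof -
  note [measurable] = minimizer_borel[OF assms(4)]
  let ?\<mu> = "emeasure (kernel_measure s)" and ?\<Omega> = "{a<..<b} \<times> {-L<..<L}"
  let ?R = "{a..b} \<times> {-L..0}" and ?R' = "{a<..<b} \<times> {-L<..<0}"
  let ?T = "{a..b} \<times> {0..L}" and ?T' = "{a<..<b} \<times> {0<..<L}"
  define v where "v x = (if x \<in> {a<..<b} then 0 else f x)" for x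
  have "0 \<le> M"
    using minimizer_bound[OF assms(4), of "(a + b) / 2"] \<open>a < b\<close> by (auto simp: field_simps)
  then have "0 < L" using \<open>M < L\<close> by simp
  have [measurable]: "v \<in> borel_measurable borel" "?\<Omega> \<in> sets borel"
    "?R \<in> sets borel" "?R' \<in> sets borel" "?T \<in> sets borel" "?T' \<in> sets borel"
    by (simp_all add: v_def[abs_def] open_Times borel_open borel_closed closed_Times)
  have swap: "prod.swap -` (?T \<times> - ?T') \<in> sets borel"
    using measurable_sets[OF borel_measurable_swap, of "?T \<times> - ?T'"] by simp
  have "cut (subgraph v) ?\<Omega> \<subseteq> ?R \<times> - ?R' \<union> prod.swap -` (?T \<times> - ?T')"
    by (auto simp: cut_def subgraph_def v_def split: if_splits)
  then have "?\<mu> (cut (subgraph v) ?\<Omega>) \<le> ?\<mu> (?R \<times> - ?R' \<union> prod.swap -` (?T \<times> - ?T'))"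
    using swap by (intro emeasure_mono) auto
  also have "\<dots> \<le> ?\<mu> (?R \<times> - ?R') + ?\<mu> (prod.swap -` (?T \<times> - ?T'))"
    using swap by (intro emeasure_subadditive) auto
  also have "\<dots> < \<infinity>"
    using kernel_measure_box_Compl_finite[OF assms(1,2), of a b "-L" 0]
      kernel_measure_box_Compl_finite[OF assms(1,2), of a b 0 L] \<open>a < b\<close> \<open>0 < L\<close>
    by (subst kernel_measure_swap) auto
  finally have "Per s (subgraph v) ?\<Omega> < \<infinity>"
    by (simp add: Per_eq_cut)
  moreover have "Per s (subgraph f) ?\<Omega> \<le> Per s (subgraph v) ?\<Omega>"
    using \<open>0 < L\<close> by (intro minimizerD[OF assms(4,5)]) (auto simp: v_def)
  ultimately show ?thesis by simp
qed

text \<open>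
  Slide the subgraph of \<open>f\<close> up by \<open>t\<close>. The intersection with the subgraph of \<open>g\<close> competes with \<open>g\<close>,
  because both have the same values off \<open>(a,b)\<close>; the union competes with the translate of \<open>f\<close>. Hence
  the two subgraphs are nested up to null sets. Off the interval the translate is strictly higher, on a
  set of positive measure, which decides the direction of the inclusion.
\<close>
lemma minimizer_le_translate:
  assumes s: "0 < s" "s < 1" and "a < b" and f: "minimizer s a b M f" and g: "minimizer s a b M g"
    and eq: "\<And>x. x \<notin> {a<..<b} \<Longrightarrow> f x = g x" and t: "0 < t"
  shows "AE x in lborel. g x \<le> f x + t"
proof -
  note [measurable] = minimizer_borel[OF f] minimizer_borel[OF g]
  let ?I = "{a<..<b}"
  define up where "up Z = (0, t) + Z" for Z :: "real \<times> real"
  define E where "E = subgraph (\<lambda>x. f x + t)"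
  define F where "F = subgraph g"
  define \<Omega> where "\<Omega> = ?I \<times> {-(M + t)<..<M + t}"
  have [measurable]: "E \<in> sets borel" "F \<in> sets borel" "\<Omega> \<in> sets borel" "up \<in> borel_measurable borel"
    by (simp_all add: E_def F_def \<Omega>_def up_def[abs_def] open_Times borel_open)
  have "0 \<le> M"
    using minimizer_bound[OF f, of "(a + b) / 2"] \<open>a < b\<close> by (auto simp: field_simps)
  have fb: "\<bar>f x\<bar> \<le> M" and gb: "\<bar>g x\<bar> \<le> M" if "x \<in> ?I" for x
    using minimizer_bound[OF f that] minimizer_bound[OF g that] by auto
  have up_Per: "Per s (up -` A) (up -` \<Omega>) = Per s A \<Omega>" if "A \<in> sets borel" for A
    using that by (intro Per_invariant) (auto simp: up_def[abs_def] lborel_distr_plus)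
  define \<Omega>' where "\<Omega>' = ?I \<times> {-(M + 2 * t)<..<M + 2 * t}"
  have [measurable]: "\<Omega>' \<in> sets borel"
    by (simp add: \<Omega>'_def open_Times borel_open)
  have up_E: "up -` E = subgraph f" and up_EF: "up -` (E \<union> F) = subgraph (\<lambda>x. max (f x) (g x - t))"
    by (auto simp: E_def F_def up_def subgraph_def)
  have up_\<Omega>: "up -` \<Omega> = ?I \<times> {- M - 2 * t<..<M}"
    by (auto simp: up_def \<Omega>_def)
  have \<Omega>'_fin: "Per s (subgraph f) \<Omega>' < \<infinity>"
    unfolding \<Omega>'_def using s \<open>a < b\<close> f t by (intro minimizer_Per_finite[where M = M]) auto
  \<comment> \<open>Sliding down again turns the window into one that is not symmetric about height 0, to which the
    minimality of \<open>f\<close> does not apply. It is embedded into the symmetric window \<open>\<Omega>'\<close>.\<close>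
  have "Per s (subgraph f) (up -` \<Omega>) \<le> Per s (subgraph (\<lambda>x. max (f x) (g x - t))) (up -` \<Omega>)"
  proof (rule Per_le_in_subwindow)
    show "up -` \<Omega> \<subseteq> \<Omega>'"
      using t by (auto simp: up_\<Omega> \<Omega>'_def)
    \<comment> \<open>Inside the strip both functions take values in \<open>[-M, M]\<close>, the smaller window ends at height \<open>M\<close>.\<close>
    show "subgraph f - up -` \<Omega> = subgraph (\<lambda>x. max (f x) (g x - t)) - up -` \<Omega>"
    proof (intro set_eqI, clarify)
      fix x y
      show "(x, y) \<in> subgraph f - up -` \<Omega> \<longleftrightarrow> (x, y) \<in> subgraph (\<lambda>x. max (f x) (g x - t)) - up -` \<Omega>"
        using fb[of x] gb[of x] eq[of x] t
        by (cases "x \<in> ?I") (auto simp: up_\<Omega> subgraph_def abs_le_iff)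
    qed
    show "Per s (subgraph f) \<Omega>' \<le> Per s (subgraph (\<lambda>x. max (f x) (g x - t))) \<Omega>'"
      unfolding \<Omega>'_def
    proof (rule minimizerD[OF f])
      show "\<bar>max (f x) (g x - t)\<bar> \<le> M + 2 * t" if "x \<in> ?I" for x
        using fb[OF that] gb[OF that] t by (auto simp: abs_le_iff max_def)
    qed (use t eq in auto)
    show "up -` \<Omega> \<in> sets borel"
      by (simp add: up_\<Omega> open_Times borel_open)
  qed (use \<Omega>'_fin in auto)
  then have E: "Per s E \<Omega> \<le> Per s (E \<union> F) \<Omega>"
    by (simp add: up_Per del: vimage_Un flip: up_E up_EF)
  have "Per s (subgraph f) (up -` \<Omega>) \<le> Per s (subgraph f) \<Omega>'"
  proof -
    have "up -` \<Omega> \<in> sets borel"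
      by (simp add: up_\<Omega> open_Times borel_open)
    moreover have "up -` \<Omega> \<subseteq> \<Omega>'"
      using t by (auto simp: up_\<Omega> \<Omega>'_def)
    ultimately show ?thesis
      by (intro Per_mono_window) auto
  qed
  then have E_fin: "Per s E \<Omega> < \<infinity>"
    using \<Omega>'_fin by (simp add: up_Per flip: up_E)
  have F: "Per s F \<Omega> \<le> Per s (E \<inter> F) \<Omega>"
    unfolding E_def F_def subgraph_min \<Omega>_def
  proof (rule minimizerD[OF g])
    show "\<bar>min (f x + t) (g x)\<bar> \<le> M + t" if "x \<in> ?I" for x
      using fb[OF that] gb[OF that] t by (auto simp: abs_le_iff min_def)
  qed (use t eq in auto)
  have F_fin: "Per s F \<Omega> < \<infinity>"
    unfolding F_def \<Omega>_def using s \<open>a < b\<close> g t by (intro minimizer_Per_finite[where M = M]) auto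
  have "F - E \<subseteq> \<Omega>"
  proof clarify
    fix x y assume xy: "(x, y) \<in> F" "(x, y) \<notin> E"
    then have "x \<in> ?I"
      using eq[of x] t by (auto simp: E_def F_def subgraph_def)
    with xy fb[of x] gb[of x] t show "(x, y) \<in> \<Omega>"
      by (auto simp: E_def F_def subgraph_def \<Omega>_def abs_le_iff)
  qed
  then have "emeasure lborel (F - E) = 0 \<or> emeasure lborel (E - F) = 0"
    by (intro minimizers_nested[OF _ _ _ _ E E_fin F F_fin]) auto
  moreover have "emeasure lborel (E - F) \<noteq> 0"
  proof
    assume "emeasure lborel (E - F) = 0"
    then have "AE x in lborel. f x + t \<le> g x"
      unfolding E_def F_def by (subst (asm) emeasure_subgraph_Diff_eq_0_iff) auto
    then have "AE x in lborel. x \<in> ?I"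
      by eventually_elim (use eq t in force)
    then have "emeasure lborel (- ?I) = 0"
      by (subst (asm) AE_iff_measurable[where N = "- ?I"]) auto
    moreover have "emeasure lborel {b..b + 1} \<le> emeasure lborel (- ?I)"
      by (intro emeasure_mono) auto
    ultimately show False by simp
  qed
  ultimately show ?thesis
    unfolding E_def F_def by (subst (asm) emeasure_subgraph_Diff_eq_0_iff) auto
qed

text \<open>
  Let the height \<open>t\<close> of the translation tend to 0, in both directions.
\<close>
lemma minimizer_unique:
  assumes "0 < s" "s < 1" "a < b" "minimizer s a b M f" "minimizer s a b M g"
    "\<And>x. x \<notin> {a<..<b} \<Longrightarrow> f x = g x"
  shows "AE x in lborel. f x = g x"
proof -
  have "AE x in lborel. g x \<le> f x + inverse (real (Suc n)) \<and> f x \<le> g x + inverse (real (Suc n))" for n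
    using minimizer_le_translate[OF assms, of "inverse (real (Suc n))"]
      minimizer_le_translate[OF assms(1-3,5,4), of "inverse (real (Suc n))"] assms(6)
    by auto
  then have "AE x in lborel. \<forall>n. g x \<le> f x + inverse (real (Suc n)) \<and> f x \<le> g x + inverse (real (Suc n))"
    unfolding AE_all_countable by blast
  then show ?thesis
  proof eventually_elim
    case (elim x)
    show ?case
    proof (rule antisym; rule field_le_epsilon)
      fix e :: real assume "0 < e"
      then obtain n where "inverse (real (Suc n)) < e" using reals_Archimedean by blast
      with elim show "f x \<le> g x + e" "g x \<le> f x + e" by (smt (verit))+
    qed
  qed
qed

section \<open>Odd reflection and polarization\<close>

definition mirror :: "real \<times> real \<Rightarrow> real \<times> real" where
  "mirror X = (- fst X, snd X)"

lemma mirror_simps [simp]: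
  "mirror (mirror X) = X" "fst (mirror X) = - fst X" "snd (mirror X) = snd X"
  "mirror (x, y) = (- x, y)"
  by (auto simp: mirror_def prod_eq_iff)

lemma borel_measurable_mirror [measurable]: "mirror \<in> borel_measurable borel"
  unfolding mirror_def[abs_def] by (intro borel_measurable_continuous_onI continuous_intros)

lemma lborel_distr_mirror: "distr lborel borel mirror = lborel"
proof -
  have "distr lborel borel (map_prod uminus id) = (lborel :: (real \<times> real) measure)"
  proof (rule distr_map_prod_lborel)
    show "distr lborel borel id = (lborel :: real measure)"
      using distr_id[of "lborel :: real measure"] by (simp add: id_def cong: distr_cong)
  qed (auto simp: lborel_distr_uminus)
  moreover have "map_prod uminus id = mirror"
    by (auto simp: mirror_def)
  ultimately show ?thesis by simp
qed

lemma kernel_mirror_both: "kernel s (mirror X, mirror Y) = kernel s (X, Y)"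
  and kernel_mirror_snd: "kernel s (X, mirror Y) = kernel s (mirror X, Y)"
  by (simp_all add: kernel_def mirror_def norm_prod_def power2_commute algebra_simps)

text \<open>
  Two points on the same side of the axis are closer to each other than either of them to the mirror
  image of the other. For \<open>X = Y\<close> the inequality fails off the axis, because the kernel has the value 0 there.
\<close>
lemma kernel_mirror_le:
  assumes "0 < s" "0 \<le> fst X * fst Y" "X \<noteq> Y"
  shows "kernel s (mirror X, Y) \<le> kernel s (X, Y)"
proof -
  have "(fst X - fst Y)\<^sup>2 \<le> (- fst X - fst Y)\<^sup>2"
    using assms(2) by (simp add: power2_eq_square algebra_simps)
  then have "norm (X - Y) \<le> norm (mirror X - Y)"
    by (simp add: norm_prod_def mirror_def)
  moreover from assms(3) have "0 < norm (X - Y)"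
    by simp
  ultimately have "norm (X - Y) powr (2 + s) \<le> norm (mirror X - Y) powr (2 + s)" "0 < norm (mirror X - Y)"
    using assms(1) by (auto intro: powr_mono2)
  with \<open>0 < norm (X - Y)\<close> show ?thesis
    by (simp add: kernel_def ennreal_leI frac_le)
qed

text \<open>
  Two-point rearrangement with respect to the vertical axis: within each pair of mirror points, a
  point of \<open>E\<close> is moved to the left one whenever possible.
\<close>
definition polarize :: "(real \<times> real) set \<Rightarrow> (real \<times> real) set" where
  "polarize E = {X. if fst X \<le> 0 then X \<in> E \<or> mirror X \<in> E else X \<in> E \<and> mirror X \<in> E}"

lemma polarize_left:
  assumes "fst X \<le> 0"
  shows "X \<in> polarize E \<longleftrightarrow> X \<in> E \<or> mirror X \<in> E" "mirror X \<in> polarize E \<longleftrightarrow> X \<in> E \<and> mirror X \<in> E"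
proof -
  have "mirror X = X" if "fst X = 0"
    using that by (auto simp: mirror_def prod_eq_iff)
  with assms show "X \<in> polarize E \<longleftrightarrow> X \<in> E \<or> mirror X \<in> E" "mirror X \<in> polarize E \<longleftrightarrow> X \<in> E \<and> mirror X \<in> E"
    by (auto simp: polarize_def)
qed

lemma polarize_right:
  assumes "0 \<le> fst X"
  shows "X \<in> polarize E \<longleftrightarrow> X \<in> E \<and> mirror X \<in> E" "mirror X \<in> polarize E \<longleftrightarrow> X \<in> E \<or> mirror X \<in> E"
  using polarize_left[of "mirror X" E] assms by auto

lemma borel_polarize [measurable]:
  assumes [measurable]: "E \<in> sets borel"
  shows "polarize E \<in> sets borel"
proof -
  have [measurable]: "mirror -` E \<in> sets borel"
    using measurable_sets[OF borel_measurable_mirror assms] by simp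
  have "polarize E = ({X. fst X \<le> 0} \<inter> (E \<union> mirror -` E)) \<union> (- {X. fst X \<le> 0} \<inter> (E \<inter> mirror -` E))"
    by (auto simp: polarize_def)
  also have "\<dots> \<in> sets borel"
    by measurable
  finally show ?thesis .
qed

text \<open>
  The contribution to a perimeter of the four pairs that consist of one of \<open>X\<close>, \<open>mirror X\<close> and one of
  \<open>Y\<close>, \<open>mirror Y\<close>. The Boolean arguments say which of these points are in the set, \<open>k\<close> is the kernel for
  \<open>(X, Y)\<close> and for the pair of mirror images, \<open>l\<close> the kernel for the two mixed pairs.
\<close>
definition pair_energy :: "ennreal \<Rightarrow> ennreal \<Rightarrow> bool \<Rightarrow> bool \<Rightarrow> bool \<Rightarrow> bool \<Rightarrow> ennreal" where
  "pair_energy k l p p' q q' =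
     k * of_bool (p \<and> \<not> q) + k * of_bool (p' \<and> \<not> q') + l * of_bool (p' \<and> \<not> q) + l * of_bool (p \<and> \<not> q')"

text \<open>
  Polarization never changes the number of separated pairs. It changes the energy only if \<open>E\<close>
  contains exactly one of \<open>X\<close>, \<open>mirror X\<close> and exactly one of \<open>Y\<close>, \<open>mirror Y\<close>, and these two are on opposite
  sides: then both are moved to the same side, and separated near pairs become separated far pairs. The
  four parts treat the possible positions of \<open>X\<close> and \<open>Y\<close> relative to the axis. The equations in the
  premises cover the pairs on the diagonal, where the kernel is 0 instead of large.
\<close>
lemma pair_energy_sort:
  shows "l \<le> k \<or> p = q \<and> p' = q' \<Longrightarrow> pair_energy k l (p \<or> p') (p \<and> p') (q \<or> q') (q \<and> q') \<le> pair_energy k l p p' q q'"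
    and "l \<le> k \<or> p = q \<and> p' = q' \<Longrightarrow> pair_energy k l (p \<and> p') (p \<or> p') (q \<and> q') (q \<or> q') \<le> pair_energy k l p p' q q'"
    and "k \<le> l \<or> p = q' \<and> p' = q \<Longrightarrow> pair_energy k l (p \<or> p') (p \<and> p') (q \<and> q') (q \<or> q') \<le> pair_energy k l p p' q q'"
    and "k \<le> l \<or> p = q' \<and> p' = q \<Longrightarrow> pair_energy k l (p \<and> p') (p \<or> p') (q \<or> q') (q \<and> q') \<le> pair_energy k l p p' q q'"
  by (cases p; cases p'; cases q; cases q'; auto simp: pair_energy_def ac_simps intro: add_mono)+

lemma pair_energy_polarize:
  assumes "0 < s"
  shows "pair_energy (kernel s (X, Y)) (kernel s (mirror X, Y))
      (X \<in> polarize E) (mirror X \<in> polarize E) (Y \<in> polarize E) (mirror Y \<in> polarize E)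
    \<le> pair_energy (kernel s (X, Y)) (kernel s (mirror X, Y)) (X \<in> E) (mirror X \<in> E) (Y \<in> E) (mirror Y \<in> E)"
    (is "pair_energy ?k ?l _ _ _ _ \<le> _")
proof -
  have same: "?l \<le> ?k \<or> (X \<in> E) = (Y \<in> E) \<and> (mirror X \<in> E) = (mirror Y \<in> E)" if "0 \<le> fst X * fst Y"
    using kernel_mirror_le[OF assms that] by blast
  have opp: "?k \<le> ?l \<or> (X \<in> E) = (mirror Y \<in> E) \<and> (mirror X \<in> E) = (Y \<in> E)" if "fst X * fst Y \<le> 0"
  proof (cases "X = mirror Y")
    case False
    then show ?thesis
      using kernel_mirror_le[OF assms, of X "mirror Y"] that
      by (simp add: kernel_mirror_both kernel_mirror_snd)
  qed auto
  consider "fst X \<le> 0" "fst Y \<le> 0" | "fst X \<le> 0" "0 \<le> fst Y" | "0 \<le> fst X" "fst Y \<le> 0" | "0 \<le> fst X" "0 \<le> fst Y"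
    by linarith
  then show ?thesis
  proof cases
    case 1
    then show ?thesis
      using pair_energy_sort(1)[OF same] by (simp add: polarize_left mult_nonpos_nonpos)
  next
    case 2
    then show ?thesis
      using pair_energy_sort(3)[OF opp] by (simp add: polarize_left polarize_right mult_nonpos_nonneg conj_commute disj_commute)
  next
    case 3
    then show ?thesis
      using pair_energy_sort(4)[OF opp] by (simp add: polarize_left polarize_right mult_nonneg_nonpos conj_commute disj_commute)
  next
    case 4
    then show ?thesis
      using pair_energy_sort(2)[OF same] by (simp add: polarize_right conj_commute disj_commute)
  qed
qed

text \<open>
  Symmetrizing the integrand under the reflection of each of the two points multiplies the integral by
  4, and after that the inequality holds pointwise.
\<close>
lemma Per_polarize_le:
  assumes "0 < s" and [measurable]: "E \<in> sets borel" "\<Omega> \<in> sets borel" and \<Omega>: "mirror -` \<Omega> = \<Omega>"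
  shows "Per s (polarize E) \<Omega> \<le> Per s E \<Omega>"
proof -
  define e where "e F Z = kernel s Z * indicator (cut F \<Omega>) Z" for F Z
  define S where "S F Z = e F Z + e F (map_prod mirror mirror Z) + e F (map_prod mirror id Z) + e F (map_prod id mirror Z)" for F Z
  have id: "distr lborel borel id = (lborel :: (real \<times> real) measure)"
    using distr_id[of "lborel :: (real \<times> real) measure"] by (simp add: id_def cong: distr_cong)
  have S: "(\<integral>\<^sup>+Z. S F Z \<partial>lborel) = 4 * Per s F \<Omega>" if [measurable]: "F \<in> sets borel" for F
  proof -
    have [measurable]: "e F \<in> borel_measurable borel"
      unfolding e_def[abs_def] by measurable
    have inv: "(\<integral>\<^sup>+Z. e F (map_prod T T' Z) \<partial>lborel) = (\<integral>\<^sup>+Z. e F Z \<partial>lborel)"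
      if "T \<in> {mirror, id}" "T' \<in> {mirror, id}" for T T'
      using that by (intro nn_integral_lborel_invariant distr_map_prod_lborel borel_measurable_map_prod)
        (auto simp: lborel_distr_mirror id)
    have [measurable]: "map_prod mirror mirror \<in> borel_measurable borel"
      "map_prod mirror id \<in> borel_measurable (borel :: ((real \<times> real) \<times> (real \<times> real)) measure)"
      "map_prod id mirror \<in> borel_measurable (borel :: ((real \<times> real) \<times> (real \<times> real)) measure)"
      by (intro borel_measurable_map_prod; simp)+
    have "(\<integral>\<^sup>+Z. S F Z \<partial>lborel) = (\<integral>\<^sup>+Z. e F Z \<partial>lborel) + (\<integral>\<^sup>+Z. e F (map_prod mirror mirror Z) \<partial>lborel)
        + (\<integral>\<^sup>+Z. e F (map_prod mirror id Z) \<partial>lborel) + (\<integral>\<^sup>+Z. e F (map_prod id mirror Z) \<partial>lborel)"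
      unfolding S_def by (simp add: nn_integral_add)
    also have "\<dots> = 4 * (\<integral>\<^sup>+Z. e F Z \<partial>lborel)"
      by (simp add: inv) (simp only: numeral_Bit0 numeral_One distrib_right mult_1 add.assoc)
    also have "(\<integral>\<^sup>+Z. e F Z \<partial>lborel) = Per s F \<Omega>"
      by (simp add: Per_eq_cut emeasure_kernel_measure e_def)
    finally show ?thesis .
  qed
  have S_eq: "S F (X, Y) = of_bool (X \<in> \<Omega> \<or> Y \<in> \<Omega>)
      * pair_energy (kernel s (X, Y)) (kernel s (mirror X, Y)) (X \<in> F) (mirror X \<in> F) (Y \<in> F) (mirror Y \<in> F)" for F X Y
  proof -
    have "mirror Z \<in> \<Omega> \<longleftrightarrow> Z \<in> \<Omega>" for Z
      using \<Omega> by auto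
    then show ?thesis
      by (auto simp: S_def e_def pair_energy_def cut_def kernel_mirror_both kernel_mirror_snd indicator_def)
  qed
  have "(\<integral>\<^sup>+Z. S (polarize E) Z \<partial>lborel) \<le> (\<integral>\<^sup>+Z. S E Z \<partial>lborel)"
  proof (rule nn_integral_mono)
    fix Z :: "(real \<times> real) \<times> real \<times> real"
    show "S (polarize E) Z \<le> S E Z"
      by (cases Z) (simp only: S_eq, intro mult_left_mono pair_energy_polarize assms(1) zero_le)
  qed
  then have "4 * Per s (polarize E) \<Omega> \<le> 4 * Per s E \<Omega>"
    by (simp add: S)
  then show ?thesis
    by (simp add: ennreal_mult_le_mult_iff)
qed

lemma AE_snd_neq_graph:
  assumes [measurable]: "f \<in> borel_measurable borel"
  shows "AE X in lebesgue. snd X \<noteq> (f (fst X) :: real)"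
proof -
  let ?G = "{X \<in> space (borel \<Otimes>\<^sub>M borel). snd X = f (fst X)}"
  have G: "?G \<in> sets (lborel \<Otimes>\<^sub>M lborel)"
    by measurable
  have "Pair x -` ?G = {f x}" for x
    by (auto simp: space_pair_measure)
  then have "emeasure (lborel \<Otimes>\<^sub>M lborel) ?G = 0"
    using lborel.emeasure_pair_measure_alt[OF G] by simp
  with G have "?G \<in> null_sets (lborel \<Otimes>\<^sub>M lborel)"
    by (intro null_setsI)
  then have "AE X in lborel. X \<notin> ?G"
    unfolding lborel_prod by (rule AE_not_in)
  then have "AE X in lborel. snd X \<noteq> f (fst X)"
    by eventually_elim (auto simp: space_pair_measure)
  then show ?thesis by (rule AE_completion)
qed

text \<open>
  The central reflection of a subgraph is a strict supergraph. Its complement differs from the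
  subgraph of the reflected function by the graph, a null set, and the perimeter does not distinguish a
  set from its complement.
\<close>
lemma Per_subgraph_odd_reflection:
  assumes [measurable]: "v \<in> borel_measurable borel"
  shows "Per s (subgraph (\<lambda>x. - v (- x))) ({-d<..<d} \<times> {-L<..<L}) = Per s (subgraph v) ({-d<..<d} \<times> {-L<..<L})"
    (is "Per s ?V ?\<Omega> = _")
proof -
  have neg: "distr lborel borel uminus = (lborel :: (real \<times> real) measure)"
    using lborel_affine[of "-1" "0 :: real \<times> real"] by (simp add: density_1)
  have [measurable]: "?\<Omega> \<in> sets borel"
    by (simp add: open_Times borel_open)
  have um: "uminus -` subgraph v \<in> sets borel"
    using measurable_sets[of uminus borel borel "subgraph v"] by simp
  have "(\<lambda>x. - v (- x)) \<in> borel_measurable borel" by measurable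
  from AE_snd_neq_graph[OF this] have "Per s ?V ?\<Omega> = Per s (- (uminus -` subgraph v)) ?\<Omega>"
    by (intro Per_cong_AE, eventually_elim) (auto simp: subgraph_def)
  also have "\<dots> = Per s (uminus -` subgraph v) (uminus -` ?\<Omega>)"
  proof -
    have "uminus -` ?\<Omega> = ?\<Omega>" by auto
    then show ?thesis using um by (simp only: Per_Compl \<open>?\<Omega> \<in> sets borel\<close>)
  qed
  also have "\<dots> = Per s (subgraph v) ?\<Omega>"
    by (intro Per_invariant neg) (auto simp: norm_minus_commute)
  finally show ?thesis .
qed

lemma minimizer_odd_reflection:
  assumes f: "minimizer s (- d) d M f"
  shows "minimizer s (- d) d M (\<lambda>x. - f (- x))"
  unfolding minimizer_def
proof (intro conjI allI impI ballI)
  note [measurable] = minimizer_borel[OF f]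
  show "(\<lambda>x. - f (- x)) \<in> borel_measurable borel" by measurable
  show "\<bar>- f (- x)\<bar> \<le> M" if "x \<in> {-d<..<d}" for x
    using minimizer_bound[OF f, of "- x"] that by auto
  fix L v assume L: "M < L" and v [measurable]: "v \<in> borel_measurable borel"
    and b: "\<forall>x\<in>{-d<..<d}. \<bar>v x\<bar> \<le> L" and out: "\<forall>x. x \<notin> {-d<..<d} \<longrightarrow> v x = - f (- x)"
  let ?\<Omega> = "{-d<..<d} \<times> {-L<..<L}"
  have "Per s (subgraph (\<lambda>x. - f (- x))) ?\<Omega> = Per s (subgraph f) ?\<Omega>"
    by (rule Per_subgraph_odd_reflection) measurable
  also have "\<dots> \<le> Per s (subgraph (\<lambda>x. - v (- x))) ?\<Omega>"
  proof (rule minimizerD[OF f L])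
    show "\<bar>- v (- x)\<bar> \<le> L" if "x \<in> {-d<..<d}" for x
      using b[rule_format, of "- x"] that by auto
    show "- v (- x) = f x" if "x \<notin> {-d<..<d}" for x
      using out[rule_format, of "- x"] that by auto
  qed measurable
  also have "\<dots> = Per s (subgraph v) ?\<Omega>"
    by (rule Per_subgraph_odd_reflection) measurable
  finally show "Per s (subgraph (\<lambda>x. - f (- x))) ?\<Omega> \<le> Per s (subgraph v) ?\<Omega>" .
qed

text \<open>
  On subgraphs, polarization takes the larger of \<open>f x\<close> and \<open>f (- x)\<close> to the left. By the sign
  condition the exterior datum is already sorted in this way, hence the polarized function has the same
  datum as \<open>f\<close>, and its energy is no larger.
\<close>
lemma minimizer_polarize:
  assumes "0 < s" and f: "minimizer s (- d) d M f" and out: "\<And>x. d \<le> x \<Longrightarrow> f x \<le> f (- x)" and "0 < d"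
  shows "minimizer s (- d) d M (\<lambda>x. if x \<le> 0 then max (f x) (f (- x)) else min (f x) (f (- x)))"
    (is "minimizer s _ d M ?g")
  unfolding minimizer_def
proof (intro conjI allI impI ballI)
  note [measurable] = minimizer_borel[OF f]
  show "?g \<in> borel_measurable borel" by measurable
  show "\<bar>?g x\<bar> \<le> M" if "x \<in> {-d<..<d}" for x
    using minimizer_bound[OF f, of "- x"] minimizer_bound[OF f, of x] that by auto
  fix L v assume L: "M < L" and v: "v \<in> borel_measurable borel"
    and b: "\<forall>x\<in>{-d<..<d}. \<bar>v x\<bar> \<le> L" and eq: "\<forall>x. x \<notin> {-d<..<d} \<longrightarrow> v x = ?g x"
  let ?\<Omega> = "{-d<..<d} \<times> {-L<..<L}"
  have "subgraph ?g = polarize (subgraph f)"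
    by (auto simp: subgraph_def polarize_def)
  then have "Per s (subgraph ?g) ?\<Omega> \<le> Per s (subgraph f) ?\<Omega>"
    using \<open>0 < s\<close> by (auto intro!: Per_polarize_le simp: open_Times borel_open)
  also have "\<dots> \<le> Per s (subgraph v) ?\<Omega>"
  proof (rule minimizerD[OF f L v])
    show "v x = f x" if "x \<notin> {-d<..<d}" for x
      using eq[rule_format, OF that] out[of x] out[of "- x"] that \<open>0 < d\<close> by (cases "x \<le> 0") auto
  qed (use b in auto)
  finally show "Per s (subgraph ?g) ?\<Omega> \<le> Per s (subgraph v) ?\<Omega>" .
qed

lemma AE_avoids_open_imp_empty:
  fixes U :: "'a::euclidean_space set"
  assumes "open U" "AE x in lebesgue. x \<notin> U"
  shows "U = {}"
proof -
  have "negligible U"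
    using assms by (simp add: negligible_iff_null_sets AE_iff_null_sets lmeasurable_open borel_open)
  then show ?thesis
    using open_not_negligible assms(1) by blast
qed

text \<open>
  Continuity turns the almost everywhere bound on \<open>u\<close> into a bound on \<open>w\<close> at every point of the
  interval, and the datum \<open>u0\<close> makes \<open>w\<close> Borel on the whole line.
\<close>
lemma s_minimal_graph_datum_imp_minimizer:
  assumes "a < b" and u: "s_minimal_graph_datum s a b u0 u" and u0: "continuous_on UNIV u0"
    and w: "continuous_representative a b u w"
  obtains M where "minimizer s a b M w"
proof -
  let ?I = "{a<..<b}"
  have u_meas: "u \<in> borel_measurable lebesgue" and "Linf_norm_on {a..b} u < \<infinity>"
    using u by (auto simp: s_minimal_graph_datum_def Linf_loc_def)
  then obtain M where M: "Linf_norm_on {a..b} u < ereal M"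
    using ereal_dense2[of "Linf_norm_on {a..b} u" "\<infinity>"] by blast
  have "AE x in lebesgue_on {a..b}. ereal \<bar>u x\<bar> \<le> Linf_norm_on {a..b} u"
    unfolding Linf_norm_on_def by (rule esssup_AE)
  then have "AE x in lebesgue. x \<in> {a..b} \<longrightarrow> ereal \<bar>u x\<bar> \<le> Linf_norm_on {a..b} u"
    by (subst (asm) AE_restrict_space_iff) auto
  then have uM: "AE x in lebesgue. x \<in> ?I \<longrightarrow> \<bar>u x\<bar> \<le> M"
    by eventually_elim (use M in \<open>force dest: order.strict_trans1\<close>)
  have w_cont: "continuous_on ?I w" and w_AE: "AE x in lebesgue. x \<in> ?I \<longrightarrow> w x = u x"
    and w_out: "\<And>x. x \<notin> ?I \<Longrightarrow> w x = u x"
    using w by (auto simp: continuous_representative_def)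
  have u_out: "u x = u0 x" if "x \<notin> ?I" for x
    using u that by (auto simp: s_minimal_graph_datum_def)
  have w_borel: "w \<in> borel_measurable borel"
  proof -
    have "w = (\<lambda>x. if x \<in> ?I then w x else u0 x)"
      using w_out u_out by auto
    moreover have "(\<lambda>x. if x \<in> ?I then w x else u0 x) \<in> borel_measurable borel"
      using w_cont u0 by (intro borel_measurable_continuous_on_if) (auto intro: continuous_on_subset)
    ultimately show ?thesis by simp
  qed
  have wM: "\<bar>w x\<bar> \<le> M" if "x \<in> ?I" for x
  proof -
    have "open {x \<in> ?I. \<bar>w x\<bar> \<in> {M<..}}"
      using continuous_open_preimage[of ?I "\<lambda>x. \<bar>w x\<bar>" "{M<..}"] w_cont
      by (simp add: continuous_on_rabs vimage_def Int_def)
    moreover have "AE x in lebesgue. x \<notin> {x \<in> ?I. \<bar>w x\<bar> \<in> {M<..}}"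
      using uM w_AE by eventually_elim auto
    ultimately have "{x \<in> ?I. \<bar>w x\<bar> \<in> {M<..}} = {}"
      by (rule AE_avoids_open_imp_empty)
    with that show ?thesis by force
  qed
  have Per_uw: "Per s (subgraph u) \<Omega> = Per s (subgraph w) \<Omega>" for \<Omega>
  proof (rule Per_cong_AE)
    have "AE x in lebesgue. u x = w x"
      using w_AE by eventually_elim (use w_out in metis)
    from AE_lebesgue_fst[OF this]
    show "AE X in lebesgue. X \<in> subgraph u \<longleftrightarrow> X \<in> subgraph w"
      by eventually_elim (auto simp: subgraph_def)
  qed
  have "minimizer s a b M w"
    unfolding minimizer_def
  proof (intro conjI allI impI ballI w_borel wM)
    fix L v assume L: "M < L" and v: "v \<in> borel_measurable borel"
      and b: "\<forall>x\<in>?I. \<bar>v x\<bar> \<le> L" and out: "\<forall>x. x \<notin> ?I \<longrightarrow> v x = w x"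
    have "(\<lambda>x. ereal \<bar>u x\<bar>) \<in> borel_measurable (lebesgue_on ?I)"
      using u_meas by (intro measurable_restrict_space1) auto
    moreover have "AE x in lebesgue_on ?I. ereal \<bar>u x\<bar> \<le> ereal M"
      using uM by (subst AE_restrict_space_iff) auto
    ultimately have "Linf_norm_on ?I u \<le> ereal M"
      unfolding Linf_norm_on_def by (rule esssup_I)
    also have "\<dots> < ereal L" using L by simp
    finally have "Linf_norm_on ?I u < ereal L" .
    moreover have "v \<in> borel_measurable lebesgue"
      using v by (simp add: measurable_completion)
    ultimately have "Per s (subgraph u) (?I \<times> {-L<..<L}) \<le> Per s (subgraph v) (?I \<times> {-L<..<L})"
      using u b out w_out u_out unfolding s_minimal_graph_datum_def by auto
    then show "Per s (subgraph w) (?I \<times> {-L<..<L}) \<le> Per s (subgraph v) (?I \<times> {-L<..<L})"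
      by (simp add: Per_uw)
  qed auto
  then show ?thesis by (rule that)
qed

theorem theorem1p2:
  fixes s d h :: real and u w :: "real \<Rightarrow> real"
  assumes "0 < s" and "s < 1" and "0 < d" and "0 < h"
    and "s_minimal_graph s (- d) d u"
    and "continuous_representative (- d) d u w"
    and "continuous_on {..<- d} u"
    and "C1_holder_on ((1 + s) / 2) {- d - h<..<- d} u"
    and "\<forall>x\<in>{d<..}. u x = - u (- x)"
    and "\<forall>x\<in>{d<..}. u x \<le> 0"
  shows "(\<forall>x. w x = - w (- x)) \<and> (\<forall>x\<in>{..0}. w x \<ge> 0) \<and> (\<forall>x\<in>{0..}. w x \<le> 0)"
proof -
  let ?I = "{-d<..<d}"
  obtain u0 where u0: "continuous_on UNIV u0" and min_u: "s_minimal_graph_datum s (- d) d u0 u"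
    using assms(5) by (auto simp: s_minimal_graph_def)
  obtain M where min: "minimizer s (- d) d M w"
    using s_minimal_graph_datum_imp_minimizer[OF _ min_u u0 assms(6)] \<open>0 < d\<close> by auto
  have "- d < d" using \<open>0 < d\<close> by simp
  have w_u0: "w x = u0 x" if "x \<notin> ?I" for x
    using that min_u assms(6) by (auto simp: s_minimal_graph_datum_def continuous_representative_def)
  have u_u0: "u x = u0 x" if "x \<notin> ?I" for x
    using that min_u by (auto simp: s_minimal_graph_datum_def)
  have closure: "closure {d<..} = {d..}"
    by (rule closure_greaterThan)
  have u0_minus: "continuous_on UNIV (\<lambda>x. u0 (- x))"
    by (rule continuous_on_compose2[OF u0]) (auto intro!: continuous_intros)
  \<comment> \<open>The hypotheses on \<open>u\<close> concern only the open half-line; the continuity of the datum extends them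
    to the endpoint \<open>d\<close>.\<close>
  have u0_sign: "u0 x \<le> 0" and u0_odd: "u0 x + u0 (- x) = 0" if "d \<le> x" for x
  proof -
    have "continuous_on (closure {d<..}) u0"
      using u0 continuous_on_subset by blast
    moreover have "u0 y \<le> 0" if "y \<in> {d<..}" for y
      using assms(10)[rule_format, of y] u_u0[of y] that by auto
    ultimately show "u0 x \<le> 0"
      using that closure by (intro continuous_le_on_closure[of "{d<..}" u0 x 0]) auto
    have "continuous_on (closure {d<..}) (\<lambda>x. u0 x + u0 (- x))"
      using u0 u0_minus continuous_on_subset by (blast intro: continuous_on_add)
    moreover have "u0 y + u0 (- y) = 0" if "y \<in> {d<..}" for y
      using assms(9)[rule_format, of y] u_u0[of y] u_u0[of "- y"] that by auto
    ultimately show "u0 x + u0 (- x) = 0"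
      using that closure by (intro continuous_constant_on_closure[of "{d<..}" "\<lambda>x. u0 x + u0 (- x)" 0 x]) auto
  qed
  have out_odd: "w x = - w (- x)" if "x \<notin> ?I" for x
    using u0_odd[of x] u0_odd[of "- x"] w_u0[OF that] w_u0[of "- x"] that by (cases "0 \<le> x") auto
  have w_cont: "continuous_on ?I w"
    using assms(6) by (simp add: continuous_representative_def)
  have w_cont_minus: "continuous_on ?I (\<lambda>x. w (- x))"
    by (rule continuous_on_compose2[OF w_cont]) (auto intro!: continuous_intros)
  \<comment> \<open>The odd reflection has the same datum, because the datum is odd.\<close>
  have odd_AE: "AE x in lborel. w x = - w (- x)"
    by (rule minimizer_unique[OF \<open>0 < s\<close> \<open>s < 1\<close> \<open>- d < d\<close> min minimizer_odd_reflection[OF min] out_odd])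
  have odd: "w x = - w (- x)" for x
  proof (cases "x \<in> ?I")
    case True
    have "open {x \<in> ?I. w x + w (- x) \<in> - {0}}"
      using continuous_open_preimage[of ?I "\<lambda>x. w x + w (- x)" "- {0}"] w_cont w_cont_minus
      by (simp add: continuous_on_add vimage_def Int_def open_Compl)
    moreover have "AE x in lebesgue. x \<notin> {x \<in> ?I. w x + w (- x) \<in> - {0}}"
      using AE_completion[OF odd_AE] by eventually_elim auto
    ultimately have "{x \<in> ?I. w x + w (- x) \<in> - {0}} = {}"
      by (rule AE_avoids_open_imp_empty)
    with True have "w x + w (- x) = 0" by blast
    then show ?thesis by simp
  qed (rule out_odd)
  have out_sign: "w x \<le> 0" if "d \<le> x" for x
    using u0_sign[OF that] w_u0[of x] that by auto
  have out_le: "w x \<le> w (- x)" if "d \<le> x" for x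
    using out_sign[OF that] odd[of x] by simp
  have pol: "minimizer s (- d) d M (\<lambda>x. if x \<le> 0 then max (w x) (w (- x)) else min (w x) (w (- x)))"
    by (rule minimizer_polarize[OF \<open>0 < s\<close> min out_le \<open>0 < d\<close>])
  have pol_AE: "AE x in lborel. w x = (if x \<le> 0 then max (w x) (w (- x)) else min (w x) (w (- x)))"
  proof (rule minimizer_unique[OF \<open>0 < s\<close> \<open>s < 1\<close> \<open>- d < d\<close> min pol])
    show "w x = (if x \<le> 0 then max (w x) (w (- x)) else min (w x) (w (- x)))" if "x \<notin> ?I" for x
      using out_le[of x] out_le[of "- x"] that \<open>0 < d\<close> by (cases "x \<le> 0") auto
  qed
  have neg: "w x \<le> 0" if "0 \<le> x" for x
  proof (cases "x < d")
    case True
    have "{0<..<d} \<subseteq> ?I" using \<open>0 < d\<close> by auto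
    then have "open {x \<in> {0<..<d}. w x \<in> {0<..}}"
      using continuous_open_preimage[of "{0<..<d}" w "{0<..}"] continuous_on_subset[OF w_cont]
      by (simp add: vimage_def Int_def)
    moreover have "AE x in lebesgue. x \<notin> {x \<in> {0<..<d}. w x \<in> {0<..}}"
      using AE_completion[OF pol_AE]
    proof eventually_elim
      case (elim x)
      then show ?case using odd[of x] by (auto simp: min_def split: if_splits)
    qed
    ultimately have "{x \<in> {0<..<d}. w x \<in> {0<..}} = {}"
      by (rule AE_avoids_open_imp_empty)
    moreover have "w 0 = 0" using odd[of 0] by simp
    ultimately show ?thesis
      using that True by (cases "x = 0") force+
  qed (use out_sign in auto)
  show ?thesis
    using odd neg by (metis atLeast_iff atMost_iff neg_0_le_iff_le)
qed

end
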